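(* The subspace elimination problem can be solved in time $O\big(m^2K\cdot\mathsf{LP}(n,mK,L)\big)$, where $K=\max_i k_i$.
   Context: Subspace elimination: the input is a collection $B_1,\dots,B_m$ of non-empty sets in $\mathbb{R}^n$, each of the form $B_i=\{x: a_{i,1}x=b_{i,1},\dots,a_{i,k_i}x=b_{i,k_i},\ c_ix<d_i\}$ (an open half-space of an affine subspace), with rational data of at most $L$ bits per number; the goal is to decide whether $\mathbb{R}^n\setminus\bigcup_{i=1}^m B_i$ is empty. $\mathsf{LP}(a,b,c)$ denotes the running time of ordinary linear programming with $a$ variables, $b$ constraints and $c$-bit numbers. *)

theory Defs
  imports Complex_Main "Jordan_Normal_Form.Matrix"
begin

text \<open>
  The model of computation is Jones' WHILE language (N. D. Jones, \<^emph>\<open>Computability and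
  Complexity\<close>): an imperative language whose only data are binary trees and whose elementary
  operations (constructing a pair, selecting a component, testing for the leaf) take unit time.
  It has no arithmetic, so all numbers are handled bit by bit.
\<close>

datatype tree = Leaf | Node tree tree

fun left :: "tree \<Rightarrow> tree" where
  "left Leaf = Leaf"
| "left (Node l r) = l"

fun right :: "tree \<Rightarrow> tree" where
  "right Leaf = Leaf"
| "right (Node l r) = r"

type_synonym store = "nat \<Rightarrow> tree"

datatype exp = EVar nat | ENil | ECons exp exp | EHd exp | ETl exp

datatype com = Assign nat exp | Seq com com | Cond exp com com | While exp com

fun eval_exp :: "exp \<Rightarrow> store \<Rightarrow> tree" where
  "eval_exp (EVar x) s = s x"
| "eval_exp ENil s = Leaf"
| "eval_exp (ECons e f) s = Node (eval_exp e s) (eval_exp f s)"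
| "eval_exp (EHd e) s = left (eval_exp e s)"
| "eval_exp (ETl e) s = right (eval_exp e s)"

fun exp_time :: "exp \<Rightarrow> nat" where
  "exp_time (EVar x) = 1"
| "exp_time ENil = 1"
| "exp_time (ECons e f) = 1 + exp_time e + exp_time f"
| "exp_time (EHd e) = 1 + exp_time e"
| "exp_time (ETl e) = 1 + exp_time e"

text \<open>\<open>exec c s t s'\<close>: started in store \<open>s\<close>, the command \<open>c\<close> terminates in store \<open>s'\<close>
  after \<open>t\<close> elementary steps.\<close>

inductive exec :: "com \<Rightarrow> store \<Rightarrow> nat \<Rightarrow> store \<Rightarrow> bool" where
  Assign: "exec (Assign x e) s (1 + exp_time e) (s(x := eval_exp e s))"
| Seq: "exec c s t s' \<Longrightarrow> exec d s' u s'' \<Longrightarrow> exec (Seq c d) s (t + u) s''"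
| CondTrue: "eval_exp e s \<noteq> Leaf \<Longrightarrow> exec c s t s' \<Longrightarrow>
    exec (Cond e c d) s (1 + exp_time e + t) s'"
| CondFalse: "eval_exp e s = Leaf \<Longrightarrow> exec d s t s' \<Longrightarrow>
    exec (Cond e c d) s (1 + exp_time e + t) s'"
| WhileFalse: "eval_exp e s = Leaf \<Longrightarrow> exec (While e c) s (1 + exp_time e) s"
| WhileTrue: "eval_exp e s \<noteq> Leaf \<Longrightarrow> exec c s t s' \<Longrightarrow> exec (While e c) s' u s'' \<Longrightarrow>
    exec (While e c) s (1 + exp_time e + t + u) s''"

text \<open>Variable 0 holds the input on start and the output on termination.\<close>

definition computes :: "com \<Rightarrow> tree \<Rightarrow> tree \<Rightarrow> nat \<Rightarrow> bool" where
  "computes p inp out t \<longleftrightarrow> (\<exists>s. exec p ((\<lambda>_. Leaf)(0 := inp)) t s \<and> s 0 = out)"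


fun enc_bool :: "bool \<Rightarrow> tree" where
  "enc_bool False = Leaf"
| "enc_bool True = Node Leaf Leaf"

fun enc_list :: "('a \<Rightarrow> tree) \<Rightarrow> 'a list \<Rightarrow> tree" where
  "enc_list f [] = Leaf"
| "enc_list f (x # xs) = Node (f x) (enc_list f xs)"

fun enc_pair :: "('a \<Rightarrow> tree) \<Rightarrow> ('b \<Rightarrow> tree) \<Rightarrow> 'a \<times> 'b \<Rightarrow> tree" where
  "enc_pair f g (x, y) = Node (f x) (g y)"

text \<open>Binary expansion, least significant bit first, without leading zeros.\<close>

fun nat_bits :: "nat \<Rightarrow> bool list" where
  "nat_bits n = (if n = 0 then [] else odd n # nat_bits (n div 2))"

declare nat_bits.simps [simp del]

definition enc_nat :: "nat \<Rightarrow> tree" where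
  "enc_nat n = enc_list enc_bool (nat_bits n)"

definition enc_int :: "int \<Rightarrow> tree" where
  "enc_int z = Node (enc_bool (z < 0)) (enc_nat (nat \<bar>z\<bar>))"

text \<open>Rationals are written as fractions in lowest terms with positive denominator.\<close>

definition enc_rat :: "rat \<Rightarrow> tree" where
  "enc_rat q = (case quotient_of q of (z, w) \<Rightarrow> Node (enc_int z) (enc_nat (nat w)))"

text \<open>One bit for the sign, plus the bits of numerator and denominator.\<close>

definition rat_bits :: "rat \<Rightarrow> nat" where
  "rat_bits q = (case quotient_of q of (z, w) \<Rightarrow>
     1 + length (nat_bits (nat \<bar>z\<bar>)) + length (nat_bits (nat w)))"

definition enc_vec :: "rat vec \<Rightarrow> tree" where
  "enc_vec v = enc_list enc_rat (list_of_vec v)"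

text \<open>A row \<open>(a, b)\<close> holds the data of a linear equation or inequality \<open>a \<bullet> x \<bowtie> b\<close>.\<close>

type_synonym row = "rat vec \<times> rat"

definition enc_row :: "row \<Rightarrow> tree" where
  "enc_row = enc_pair enc_vec enc_rat"

definition vec_ok :: "nat \<Rightarrow> nat \<Rightarrow> rat vec \<Rightarrow> bool" where
  "vec_ok n L a \<longleftrightarrow> a \<in> carrier_vec n \<and> (\<forall>i < n. rat_bits (a $ i) \<le> L)"

definition row_ok :: "nat \<Rightarrow> nat \<Rightarrow> row \<Rightarrow> bool" where
  "row_ok n L r \<longleftrightarrow> vec_ok n L (fst r) \<and> rat_bits (snd r) \<le> L"

definition lin :: "rat vec \<Rightarrow> real vec \<Rightarrow> real" where
  "lin a x = map_vec of_rat a \<bullet> x"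


text \<open>Linear programming: maximise \<open>f \<bullet> x\<close> over \<open>x \<in> \<real>\<^sup>n\<close> subject to \<open>a \<bullet> x \<le> b\<close> for the
  rows \<open>(a, b)\<close> of a list of constraints.\<close>

definition feasible_set :: "nat \<Rightarrow> row list \<Rightarrow> real vec set" where
  "feasible_set n rs = {x \<in> carrier_vec n. \<forall>(a, b) \<in> set rs. lin a x \<le> of_rat b}"

datatype lp_result = Infeasible | Unbounded | Optimum rat

fun lp_answer :: "nat \<Rightarrow> rat vec \<Rightarrow> row list \<Rightarrow> lp_result \<Rightarrow> bool" where
  "lp_answer n f rs Infeasible \<longleftrightarrow> feasible_set n rs = {}"
| "lp_answer n f rs Unbounded \<longleftrightarrow>
     feasible_set n rs \<noteq> {} \<and> \<not> bdd_above (lin f ` feasible_set n rs)"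
| "lp_answer n f rs (Optimum v) \<longleftrightarrow>
     (\<exists>x \<in> feasible_set n rs. lin f x = of_rat v) \<and>
     (\<forall>x \<in> feasible_set n rs. lin f x \<le> of_rat v)"

fun enc_lp_result :: "lp_result \<Rightarrow> tree" where
  "enc_lp_result Infeasible = Leaf"
| "enc_lp_result Unbounded = Node Leaf Leaf"
| "enc_lp_result (Optimum v) = Node (enc_bool True) (enc_rat v)"

definition enc_lp :: "rat vec \<times> row list \<Rightarrow> tree" where
  "enc_lp = enc_pair enc_vec (enc_list enc_row)"

text \<open>\<open>T a b c\<close> bounds the running time on all linear programs with \<open>a\<close> variables, at most \<open>b\<close>
  constraints and numbers of at most \<open>c\<close> bits.\<close>

definition solves_linear_programming :: "com \<Rightarrow> (nat \<Rightarrow> nat \<Rightarrow> nat \<Rightarrow> nat) \<Rightarrow> bool" where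
  "solves_linear_programming p T \<longleftrightarrow>
    (\<forall>a b c f rs. vec_ok a c f \<and> length rs \<le> b \<and> (\<forall>r \<in> set rs. row_ok a c r) \<longrightarrow>
      (\<exists>r t. lp_answer a f rs r \<and> computes p (enc_lp (f, rs)) (enc_lp_result r) t \<and>
             t \<le> T a b c))"


text \<open>An element \<open>(eqs, (c, d))\<close> describes the set given by the equations \<open>eqs\<close> and \<open>c \<bullet> x < d\<close>.\<close>

type_synonym block = "row list \<times> row"

fun block_set :: "nat \<Rightarrow> block \<Rightarrow> real vec set" where
  "block_set n (eqs, (c, d)) =
    {x \<in> carrier_vec n. (\<forall>(a, b) \<in> set eqs. lin a x = of_rat b) \<and> lin c x < of_rat d}"

definition enc_blocks :: "block list \<Rightarrow> tree" where
  "enc_blocks = enc_list (enc_pair (enc_list enc_row) enc_row)"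

definition elim_instance :: "nat \<Rightarrow> nat \<Rightarrow> block list \<Rightarrow> bool" where
  "elim_instance n L Bs \<longleftrightarrow> Bs \<noteq> [] \<and>
    (\<forall>(eqs, ineq) \<in> set Bs. (\<forall>r \<in> set eqs. row_ok n L r) \<and> row_ok n L ineq \<and>
       block_set n (eqs, ineq) \<noteq> {})"

text \<open>The largest number of equations of a block. The value is at least 1, because for a collection
  of full-dimensional half-spaces (no equations at all) the bound \<open>m\<^sup>2 K \<cdot> LP(n, m K, L)\<close> would
  otherwise vanish.\<close>

definition max_eqs :: "block list \<Rightarrow> nat" where
  "max_eqs Bs = Max (insert 1 ((\<lambda>(eqs, ineq). length eqs) ` set Bs))"

text \<open>\<open>T n m K L\<close> bounds the running time on inputs in \<open>\<real>\<^sup>n\<close> with \<open>m\<close> sets, at most \<open>K\<close> equations per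
  set and numbers of at most \<open>L\<close> bits.\<close>

definition solves_subspace_elimination ::
    "com \<Rightarrow> (nat \<Rightarrow> nat \<Rightarrow> nat \<Rightarrow> nat \<Rightarrow> nat) \<Rightarrow> bool" where
  "solves_subspace_elimination p T \<longleftrightarrow>
    (\<forall>n L Bs. elim_instance n L Bs \<longrightarrow>
      (\<exists>t. computes p (enc_blocks Bs)
             (enc_bool (carrier_vec n - (\<Union>B \<in> set Bs. block_set n B) = {})) t \<and>
           t \<le> T n (length Bs) (max_eqs Bs) L))"

end

theory Submission
  imports Defs
begin

text \<open>
  The complement of a set \<open>B\<^sub>i\<close> is given by a disjunction of disequations and the single weak inequality
  \<open>c\<^sub>i x \<ge> d\<^sub>i\<close>. Start with \<open>P = \<real>\<^sup>n\<close> and keep a polyhedron \<open>P\<close> containing the complement of the union: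
  whenever \<open>P\<close> satisfies all equations of some remaining \<open>B\<^sub>i\<close>, none of its disequations can be
  satisfied, so \<open>c\<^sub>i x \<ge> d\<^sub>i\<close> is added to \<open>P\<close>. Once no further set can be treated, \<open>P\<close> is convex and
  not contained in any of the remaining affine subspaces, hence not in their union, and the complement is
  empty iff \<open>P\<close> is. Each containment test takes two linear programs per equation \<open>a x = b\<close>,
  maximising \<open>a x\<close> and \<open>- a x\<close> over \<open>P\<close>, which gives \<open>O(m\<^sup>2 K)\<close> linear programs with at most \<open>m\<close>
  constraints.

  The remaining work per linear program is the negation of a vector and the comparison of the optimum with
  \<open>b\<close>, i.e. \<open>O(n + L)\<close> steps. It is absorbed by the solver's own running time: a program that runs for
  \<open>t\<close> steps sees its input only up to depth \<open>t\<close>, so a correct solver needs time \<open>\<Omega>(n)\<close> and, if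
  \<open>n > 0\<close>, also \<open>\<Omega>(L)\<close>.
\<close>

section \<open>Reasoning about programs\<close>

text \<open>Total correctness with running time: termination is part of the claim, and the
  postcondition receives the step count, so results and time bounds are proved together.\<close>

definition wp :: "com \<Rightarrow> store \<Rightarrow> (nat \<Rightarrow> store \<Rightarrow> bool) \<Rightarrow> bool" where
  "wp c s Q \<longleftrightarrow> (\<exists>t s'. exec c s t s' \<and> Q t s')"

lemma exec_Assign_iff:
  "exec (Assign x e) s t s' \<longleftrightarrow> t = 1 + exp_time e \<and> s' = s(x := eval_exp e s)"
  by (subst exec.simps) auto

lemma exec_Seq_iff:
  "exec (Seq c d) s t s' \<longleftrightarrow> (\<exists>u v r. t = u + v \<and> exec c s u r \<and> exec d r v s')"
  by (subst exec.simps) auto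

lemma exec_Cond_iff:
  "exec (Cond e c d) s t s' \<longleftrightarrow>
    (\<exists>u. t = 1 + exp_time e + u \<and> exec (if eval_exp e s \<noteq> Leaf then c else d) s u s')"
  by (subst exec.simps) auto

lemma exec_While_Leaf_iff:
  "eval_exp e s = Leaf \<Longrightarrow> exec (While e c) s t s' \<longleftrightarrow> t = 1 + exp_time e \<and> s' = s"
  by (subst exec.simps) auto

lemma exec_While_Node_iff:
  "eval_exp e s \<noteq> Leaf \<Longrightarrow> exec (While e c) s t s' \<longleftrightarrow>
    (\<exists>u v r. t = 1 + exp_time e + u + v \<and> exec c s u r \<and> exec (While e c) r v s')"
  by (subst exec.simps) auto

lemma wp_Assign [simp]: "wp (Assign x e) s Q \<longleftrightarrow> Q (1 + exp_time e) (s(x := eval_exp e s))"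
  unfolding wp_def exec_Assign_iff by simp

lemma wp_Seq [simp]: "wp (Seq c d) s Q \<longleftrightarrow> wp c s (\<lambda>t s'. wp d s' (\<lambda>u. Q (t + u)))"
  unfolding wp_def exec_Seq_iff by blast

lemma wp_Cond [simp]:
  "wp (Cond e c d) s Q \<longleftrightarrow>
    wp (if eval_exp e s \<noteq> Leaf then c else d) s (\<lambda>t. Q (1 + exp_time e + t))"
  unfolding wp_def exec_Cond_iff by blast

text \<open>The two loop equations are conditional on the guard and kept out of the simp set,
  because the second one reproduces the loop on its right-hand side.\<close>

lemma wp_While_Leaf:
  "eval_exp e s = Leaf \<Longrightarrow> wp (While e c) s Q \<longleftrightarrow> Q (1 + exp_time e) s"
  unfolding wp_def by (simp add: exec_While_Leaf_iff)

lemma wp_While_Node: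
  assumes "eval_exp e s \<noteq> Leaf"
  shows "wp (While e c) s Q \<longleftrightarrow>
    wp c s (\<lambda>t s'. wp (While e c) s' (\<lambda>u. Q (1 + exp_time e + t + u)))"
  unfolding wp_def exec_While_Node_iff[OF assms] by blast

section \<open>Frame rules: variables that a program leaves untouched\<close>

fun modified :: "com \<Rightarrow> nat set" where
  "modified (Assign x e) = {x}"
| "modified (Seq c d) = modified c \<union> modified d"
| "modified (Cond e c d) = modified c \<union> modified d"
| "modified (While e c) = modified c"

lemma exec_unmodified: "exec c s t s' \<Longrightarrow> x \<notin> modified c \<Longrightarrow> s' x = s x"
  by (induction rule: exec.induct) auto

text \<open>A consequence rule that also supplies the frame fact, so that specifications need to
  mention only the variables that change.\<close>

lemma wp_frame:
  assumes "wp c s Q" and "\<And>t s'. Q t s' \<Longrightarrow> (\<forall>x. x \<notin> modified c \<longrightarrow> s' x = s x) \<Longrightarrow> R t s'"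
  shows "wp c s R"
proof -
  obtain t s' where "exec c s t s'" "Q t s'"
    using assms(1) unfolding wp_def by blast
  then have "R t s'" using assms(2) exec_unmodified by simp
  with \<open>exec c s t s'\<close> show ?thesis unfolding wp_def by blast
qed

lemma wp_SeqI:
  assumes "wp c s P"
    and "\<And>t s'. P t s' \<Longrightarrow> (\<forall>x. x \<notin> modified c \<longrightarrow> s' x = s x) \<Longrightarrow> wp d s' (\<lambda>u. Q (t + u))"
  shows "wp (Seq c d) s Q"
  unfolding wp_Seq by (rule wp_frame[OF assms(1)]) (rule assms(2))

lemma wp_WhileI:
  assumes "eval_exp e s \<noteq> Leaf" and "wp c s P"
    and "\<And>t s'. P t s' \<Longrightarrow> (\<forall>x. x \<notin> modified c \<longrightarrow> s' x = s x) \<Longrightarrow>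
      wp (While e c) s' (\<lambda>u. Q (1 + exp_time e + t + u))"
  shows "wp (While e c) s Q"
  unfolding wp_While_Node[OF assms(1)] by (rule wp_frame[OF assms(2)]) (rule assms(3))

section \<open>Moving a run to another store\<close>

fun exp_vars :: "exp \<Rightarrow> nat set" where
  "exp_vars (EVar x) = {x}"
| "exp_vars ENil = {}"
| "exp_vars (ECons e f) = exp_vars e \<union> exp_vars f"
| "exp_vars (EHd e) = exp_vars e"
| "exp_vars (ETl e) = exp_vars e"

fun com_vars :: "com \<Rightarrow> nat set" where
  "com_vars (Assign x e) = insert x (exp_vars e)"
| "com_vars (Seq c d) = com_vars c \<union> com_vars d"
| "com_vars (Cond e c d) = exp_vars e \<union> com_vars c \<union> com_vars d"
| "com_vars (While e c) = exp_vars e \<union> com_vars c"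

lemma finite_com_vars: "finite (com_vars c)"
proof -
  have "finite (exp_vars e)" for e by (induction e) auto
  then show ?thesis by (induction c) auto
qed

lemma modified_subset_com_vars: "modified c \<subseteq> com_vars c"
  by (induction c) auto

lemma eval_exp_cong: "(\<And>x. x \<in> exp_vars e \<Longrightarrow> s x = s' x) \<Longrightarrow> eval_exp e s = eval_exp e s'"
  by (induction e) auto

text \<open>A run reads and writes only variables of its program, so it can be replayed in any store
  that agrees on those. This is how a solver specified on an otherwise empty store can be called
  while the caller's data sit in other variables. A superset \<open>V\<close> replaces
  \<open>com_vars c\<close> so that all subcommands share one set in the induction.\<close>

lemma exec_relocate:
  assumes "exec c s t s'" and "com_vars c \<subseteq> V" and "\<And>x. x \<in> V \<Longrightarrow> r x = s x"
  shows "exec c r t (\<lambda>x. if x \<in> V then s' x else r x)"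
  using assms
proof (induction arbitrary: r rule: exec.induct)
  case (Assign x e s)
  have "eval_exp e r = eval_exp e s"
    using Assign.prems by (intro eval_exp_cong) auto
  then have "(\<lambda>y. if y \<in> V then (s(x := eval_exp e s)) y else r y) = r(x := eval_exp e r)"
    using Assign by (auto simp: fun_eq_iff)
  then show ?case by (simp only: exec.Assign)
next
  case (Seq c s t s' d u s'')
  let ?r = "\<lambda>x. if x \<in> V then s' x else r x"
  have "exec c r t ?r" using Seq.IH(1) Seq.prems by simp
  moreover have "exec d ?r u (\<lambda>x. if x \<in> V then s'' x else ?r x)"
    by (rule Seq.IH) (use Seq.prems in auto)
  ultimately have "exec (Seq c d) r (t + u) (\<lambda>x. if x \<in> V then s'' x else ?r x)"
    by (rule exec.Seq)
  moreover have "(\<lambda>x. if x \<in> V then s'' x else ?r x) = (\<lambda>x. if x \<in> V then s'' x else r x)"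
    by auto
  ultimately show ?case by simp
next
  case (CondTrue e s c t s' d)
  have "eval_exp e r = eval_exp e s"
    using CondTrue.prems by (intro eval_exp_cong) auto
  then show ?case using CondTrue by (intro exec.CondTrue) auto
next
  case (CondFalse e s d t s' c)
  have "eval_exp e r = eval_exp e s"
    using CondFalse.prems by (intro eval_exp_cong) auto
  then show ?case using CondFalse by (intro exec.CondFalse) auto
next
  case (WhileFalse e s c)
  have "eval_exp e r = eval_exp e s"
    using WhileFalse.prems by (intro eval_exp_cong) auto
  moreover have "(\<lambda>x. if x \<in> V then s x else r x) = r"
    using WhileFalse by auto
  ultimately show ?case using WhileFalse exec.WhileFalse[of e r c] by simp
next
  case (WhileTrue e s c t s' u s'')
  let ?r = "\<lambda>x. if x \<in> V then s' x else r x"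
  have "eval_exp e r = eval_exp e s"
    using WhileTrue.prems by (intro eval_exp_cong) auto
  moreover have "exec c r t ?r" using WhileTrue.IH(1) WhileTrue.prems by simp
  moreover have "exec (While e c) ?r u (\<lambda>x. if x \<in> V then s'' x else ?r x)"
    by (rule WhileTrue.IH) (use WhileTrue.prems in auto)
  ultimately have "exec (While e c) r (1 + exp_time e + t + u)
      (\<lambda>x. if x \<in> V then s'' x else ?r x)"
    using WhileTrue.hyps by (intro exec.WhileTrue) simp_all
  moreover have "(\<lambda>x. if x \<in> V then s'' x else ?r x) = (\<lambda>x. if x \<in> V then s'' x else r x)"
    by auto
  ultimately show ?case by simp
qed

section \<open>Programs see their input only up to a bounded depth\<close>

fun trunc :: "nat \<Rightarrow> tree \<Rightarrow> tree" where
  "trunc 0 x = Leaf"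
| "trunc (Suc k) Leaf = Leaf"
| "trunc (Suc k) (Node x y) = Node (trunc k x) (trunc k y)"

lemma trunc_Leaf [simp]: "trunc k Leaf = Leaf"
  by (cases k) auto

lemma trunc_trunc: "j \<le> k \<Longrightarrow> trunc j (trunc k x) = trunc j x"
proof (induction j x arbitrary: k rule: trunc.induct)
  case (3 j x y)
  then show ?case by (cases k) auto
qed auto

lemma trunc_eq_mono: "trunc k x = trunc k y \<Longrightarrow> j \<le> k \<Longrightarrow> trunc j x = trunc j y"
  by (rule trans[OF trunc_trunc[symmetric] trans[OF arg_cong[of _ _ "trunc j"] trunc_trunc]])

lemma trunc_eq_Leaf_iff: "trunc k x = trunc k y \<Longrightarrow> 0 < k \<Longrightarrow> x = Leaf \<longleftrightarrow> y = Leaf"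
  by (cases k; cases x; cases y) auto

lemma trunc_eq_left: "trunc (Suc k) x = trunc (Suc k) y \<Longrightarrow> trunc k (left x) = trunc k (left y)"
  by (cases x; cases y) auto

lemma trunc_eq_right: "trunc (Suc k) x = trunc (Suc k) y \<Longrightarrow> trunc k (right x) = trunc k (right y)"
  by (cases x; cases y) auto

text \<open>Every selector brings one hidden level into view and costs one unit of time, so
  evaluation loses at most \<open>exp_time e\<close> levels of agreement.\<close>

lemma trunc_eval_exp:
  assumes "\<And>x. trunc d (s x) = trunc d (s' x)" and "exp_time e + k \<le> d"
  shows "trunc k (eval_exp e s) = trunc k (eval_exp e s')"
  using assms(2)
proof (induction e arbitrary: k)
  case (EVar x)
  then show ?case by (simp, intro trunc_eq_mono[OF assms(1)]) simp
next
  case (ECons e f)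
  then show ?case by (cases k) auto
next
  case (EHd e)
  then show ?case by (simp, intro trunc_eq_left) simp
next
  case (ETl e)
  then show ?case by (simp, intro trunc_eq_right) simp
qed simp

lemma trunc_eval_exp_Leaf_iff:
  assumes "\<And>x. trunc d (s x) = trunc d (s' x)" and "exp_time e < d"
  shows "eval_exp e s = Leaf \<longleftrightarrow> eval_exp e s' = Leaf"
  by (rule trunc_eq_Leaf_iff[OF trunc_eval_exp[OF assms(1), of e 1]]) (use assms(2) in simp_all)

text \<open>Each elementary step consumes at most one level of agreement. While some level remains,
  the guards have the same truth value in both stores, so both runs take the same branches and the
  same time.\<close>

lemma exec_trunc:
  assumes "exec c s t s'" and "exec c r u r'"
    and "\<And>x. trunc d (s x) = trunc d (r x)" and "t + k = d"
  shows "u = t \<and> (\<forall>x. trunc k (s' x) = trunc k (r' x))"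
  using assms
proof (induction arbitrary: r u r' d k rule: exec.induct)
  case (Assign x e s)
  have "trunc k (eval_exp e s) = trunc k (eval_exp e r)"
    by (rule trunc_eval_exp[OF Assign.prems(2)]) (use Assign.prems(3) in simp)
  moreover have "trunc k (s y) = trunc k (r y)" for y
    by (rule trunc_eq_mono[OF Assign.prems(2)]) (use Assign.prems(3) in simp)
  ultimately show ?case
    using Assign.prems(1) by (simp add: exec_Assign_iff)
next
  case (Seq c s t s' d' v s'')
  from Seq.prems(1) obtain u1 u2 q where q: "exec c r u1 q" "exec d' q u2 r'" "u = u1 + u2"
    by (auto simp: exec_Seq_iff)
  \<comment> \<open>Agreement to depth \<open>v + k\<close> is kept after the first command, since
    the second one will consume \<open>v\<close> levels of it.\<close>
  have 1: "u1 = t \<and> (\<forall>x. trunc (v + k) (s' x) = trunc (v + k) (q x))"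
    using Seq.IH(1)[OF q(1) Seq.prems(2), of "v + k"] Seq.prems(3) by simp
  then have "u2 = v \<and> (\<forall>x. trunc k (s'' x) = trunc k (r' x))"
    by (intro Seq.IH(2)[OF q(2) _ refl]) simp
  with 1 q(3) show ?case by simp
next
  case (CondTrue e s c t s' d')
  have *: "eval_exp e r \<noteq> Leaf"
    using trunc_eval_exp_Leaf_iff[OF CondTrue.prems(2), of e] CondTrue.hyps(1) CondTrue.prems(3) by simp
  with CondTrue.prems(1) obtain u1 where q: "exec c r u1 r'" "u = 1 + exp_time e + u1"
    by (auto simp: exec_Cond_iff)
  have "\<And>x. trunc (t + k) (s x) = trunc (t + k) (r x)"
    using trunc_eq_mono[OF CondTrue.prems(2)] CondTrue.prems(3) by simp
  from CondTrue.IH[OF q(1) this refl] q(2) show ?case by simp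
next
  case (CondFalse e s d' t s' c)
  have *: "eval_exp e r = Leaf"
    using trunc_eval_exp_Leaf_iff[OF CondFalse.prems(2), of e] CondFalse.hyps(1) CondFalse.prems(3) by simp
  with CondFalse.prems(1) obtain u1 where q: "exec d' r u1 r'" "u = 1 + exp_time e + u1"
    by (auto simp: exec_Cond_iff)
  have "\<And>x. trunc (t + k) (s x) = trunc (t + k) (r x)"
    using trunc_eq_mono[OF CondFalse.prems(2)] CondFalse.prems(3) by simp
  from CondFalse.IH[OF q(1) this refl] q(2) show ?case by simp
next
  case (WhileFalse e s c)
  have *: "eval_exp e r = Leaf"
    using trunc_eval_exp_Leaf_iff[OF WhileFalse.prems(2), of e] WhileFalse.hyps(1) WhileFalse.prems(3) by simp
  with WhileFalse.prems(1) have "u = 1 + exp_time e" "r' = r"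
    by (simp_all add: exec_While_Leaf_iff)
  then show ?case using trunc_eq_mono[OF WhileFalse.prems(2)] WhileFalse.prems(3) by simp
next
  case (WhileTrue e s c t s' v s'')
  have *: "eval_exp e r \<noteq> Leaf"
    using trunc_eval_exp_Leaf_iff[OF WhileTrue.prems(2), of e] WhileTrue.hyps(1) WhileTrue.prems(3) by simp
  with WhileTrue.prems(1) obtain u1 u2 q where
    q: "exec c r u1 q" "exec (While e c) q u2 r'" "u = 1 + exp_time e + u1 + u2"
    using exec_While_Node_iff by blast
  have "\<And>x. trunc (t + (v + k)) (s x) = trunc (t + (v + k)) (r x)"
    using trunc_eq_mono[OF WhileTrue.prems(2)] WhileTrue.prems(3) by simp
  then have 1: "u1 = t \<and> (\<forall>x. trunc (v + k) (s' x) = trunc (v + k) (q x))"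
    by (rule WhileTrue.IH(1)[OF q(1) _ refl])
  then have "u2 = v \<and> (\<forall>x. trunc k (s'' x) = trunc k (r' x))"
    by (intro WhileTrue.IH(2)[OF q(2) _ refl]) simp
  with 1 q(3) show ?case by simp
qed

lemma exec_time_pos: "exec c s t s' \<Longrightarrow> 0 < t"
  by (induction rule: exec.induct) auto

lemma computes_trunc:
  assumes "computes p inp out t" and "computes p inp' out' t'"
    and "trunc (t + k) inp = trunc (t + k) inp'"
  shows "trunc k out = trunc k out'"
proof -
  let ?s = "(\<lambda>_. Leaf)(0 := inp)" and ?r = "(\<lambda>_. Leaf)(0 := inp')"
  obtain s where s: "exec p ?s t s \<and> s 0 = out"
    using assms(1) unfolding computes_def ..
  obtain r where r: "exec p ?r t' r \<and> r 0 = out'"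
    using assms(2) unfolding computes_def ..
  have *: "trunc (t + k) (?s x) = trunc (t + k) (?r x)" for x
    using assms(3) by simp
  have "\<forall>x. trunc k (s x) = trunc k (r x)"
    using exec_trunc[OF conjunct1[OF s] conjunct1[OF r] *] by blast
  then have "trunc k (s 0) = trunc k (r 0)" ..
  then show ?thesis using s r by simp
qed

lemma trunc_enc_list:
  "trunc (length xs) (enc_list f (xs @ ys)) = trunc (length xs) (enc_list f (xs @ zs))"
  by (induction xs) auto

section \<open>Encodings\<close>

lemma nat_bits_0 [simp]: "nat_bits 0 = []"
  by (simp add: nat_bits.simps)

lemma nat_bits_pos: "0 < n \<Longrightarrow> nat_bits n = odd n # nat_bits (n div 2)"
  by (simp add: nat_bits.simps)

lemma nat_bits_1 [simp]: "nat_bits 1 = [True]" "nat_bits (Suc 0) = [True]"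
  by (simp_all add: nat_bits_pos)

lemma nat_bits_eq_Nil_iff [simp]: "nat_bits n = [] \<longleftrightarrow> n = 0"
  by (cases "n = 0") (simp_all add: nat_bits_pos)

lemma nat_bits_inject: "nat_bits m = nat_bits n \<longleftrightarrow> m = n"
proof
  show "nat_bits m = nat_bits n \<Longrightarrow> m = n"
  proof (induction m arbitrary: n rule: less_induct)
    case (less m)
    show ?case
    proof (cases "m = 0 \<or> n = 0")
      case True
      then show ?thesis using less.prems nat_bits_eq_Nil_iff by metis
    next
      case False
      then have "odd m = odd n" "nat_bits (m div 2) = nat_bits (n div 2)"
        using less.prems by (simp_all add: nat_bits_pos)
      moreover have "m div 2 = n div 2"
        using less.IH[of "m div 2" "n div 2"] False calculation(2) by simp
      ultimately show ?thesis by (metis even_two_times_div_two odd_two_times_div_two_succ)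
    qed
  qed
qed simp

text \<open>These numbers have bit lists that are prefixes of each other, hence encodings that agree
  to a large depth.\<close>

lemma nat_bits_mask: "nat_bits (2 ^ k - 1) = replicate k True"
proof (induction k)
  case (Suc k)
  have "(2::nat) ^ Suc k - 1 = 2 * (2 ^ k - 1) + 1"
    using one_le_power[of "2::nat" k] unfolding power_Suc by linarith
  then have "odd ((2::nat) ^ Suc k - 1)" "((2::nat) ^ Suc k - 1) div 2 = 2 ^ k - 1" "(2::nat) ^ Suc k - 1 > 0"
    by simp_all
  with Suc show ?case by (simp add: nat_bits_pos del: power_Suc)
qed simp

lemma enc_bool_inject [simp]: "enc_bool x = enc_bool y \<longleftrightarrow> x = y"
  by (cases x; cases y) auto

lemma enc_bool_eq_Leaf_iff [simp]: "enc_bool b = Leaf \<longleftrightarrow> \<not> b"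
  by (cases b) auto

lemma enc_list_inject: "(\<And>x y. f x = f y \<longleftrightarrow> x = y) \<Longrightarrow> enc_list f xs = enc_list f ys \<longleftrightarrow> xs = ys"
proof (induction xs arbitrary: ys)
  case Nil
  then show ?case by (cases ys) auto
next
  case (Cons x xs)
  then show ?case by (cases ys) auto
qed

lemma enc_list_eq_Leaf_iff [simp]: "enc_list f xs = Leaf \<longleftrightarrow> xs = []"
  by (cases xs) auto

lemma enc_nat_inject [simp]: "enc_nat m = enc_nat n \<longleftrightarrow> m = n"
  by (simp add: enc_nat_def enc_list_inject nat_bits_inject)

lemma enc_nat_0 [simp]: "enc_nat 0 = Leaf"
  by (simp add: enc_nat_def)

lemma enc_nat_eq_Leaf_iff [simp]: "enc_nat n = Leaf \<longleftrightarrow> n = 0"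
  by (simp add: enc_nat_def)

lemma enc_int_inject [simp]: "enc_int x = enc_int y \<longleftrightarrow> x = y"
  by (auto simp: enc_int_def)

text \<open>Lowest terms make the encoding unique, so a program can test equality of rationals by
  comparing trees.\<close>

lemma enc_rat_inject [simp]: "enc_rat p = enc_rat q \<longleftrightarrow> p = q"
proof
  assume *: "enc_rat p = enc_rat q"
  obtain z w where p: "quotient_of p = (z, w)" by fastforce
  obtain z' w' where q: "quotient_of q = (z', w')" by fastforce
  have "z = z'" "nat w = nat w'"
    using * p q by (simp_all add: enc_rat_def)
  moreover have "0 < w" "0 < w'"
    using p q quotient_of_denom_pos by blast+
  ultimately have "quotient_of p = quotient_of q"
    using p q by simp
  then show "p = q" by (simp add: quotient_of_inject)
qed simp

lemma enc_rat_of_int: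
  "enc_rat (of_int z) = Node (Node (enc_bool (z < 0)) (enc_nat (nat \<bar>z\<bar>))) (enc_nat 1)"
  by (simp add: enc_rat_def enc_int_def)

lemma rat_bits_of_int: "rat_bits (of_int z) = 2 + length (nat_bits (nat \<bar>z\<bar>))"
  by (simp add: rat_bits_def)

lemma rat_bits_small [simp]: "rat_bits 0 = 2" "rat_bits 1 = 3" "rat_bits (-1) = 3"
  using rat_bits_of_int[of 0] rat_bits_of_int[of 1] rat_bits_of_int[of "-1"] by simp_all

lemma rat_bits_uminus [simp]: "rat_bits (- q) = rat_bits q"
  by (simp add: rat_bits_def rat_uminus_code Let_def split: prod.splits)

text \<open>The sign takes one bit and the positive denominator at least one more, which leaves none
  for the numerator.\<close>

lemma rat_bits_le_2D:
  assumes "rat_bits q \<le> 2"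
  shows "q = 0"
proof -
  obtain z w where q: "quotient_of q = (z, w)" by fastforce
  then have "0 < w" using quotient_of_denom_pos by blast
  then have "nat_bits (nat w) \<noteq> []" by simp
  then have "length (nat_bits (nat w)) \<ge> 1" by (cases "nat_bits (nat w)") auto
  then have "length (nat_bits (nat \<bar>z\<bar>)) = 0" using assms q by (simp add: rat_bits_def del: length_0_conv)
  then have "z = 0" by simp
  then show ?thesis using q quotient_of_div by fastforce
qed

fun tree_size :: "tree \<Rightarrow> nat" where
  "tree_size Leaf = 1"
| "tree_size (Node x y) = 1 + tree_size x + tree_size y"

lemma tree_size_enc_nat: "tree_size (enc_nat n) \<le> 4 * length (nat_bits n) + 1"
proof -
  have "tree_size (enc_bool b) \<le> 3" for b by (cases b) auto
  then have "tree_size (enc_list enc_bool bs) \<le> 4 * length bs + 1" for bs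
  proof (induction bs)
    case (Cons b bs)
    from Cons.IH[OF Cons.prems] Cons.prems[of b] show ?case by simp
  qed simp
  then show ?thesis by (simp add: enc_nat_def)
qed

lemma tree_size_enc_rat: "tree_size (enc_rat q) \<le> 4 * rat_bits q + 7"
proof -
  obtain z w where q: "quotient_of q = (z, w)" by fastforce
  have "tree_size (enc_bool b) \<le> 3" for b by (cases b) auto
  from this[of "z < 0"] show ?thesis
    using q tree_size_enc_nat[of "nat \<bar>z\<bar>"] tree_size_enc_nat[of "nat w"]
    by (simp add: enc_rat_def enc_int_def rat_bits_def)
qed

lemma list_of_vec_conv_map: "list_of_vec v = map (\<lambda>i. v $ i) [0..<dim_vec v]"
  by (rule nth_equalityI) (auto simp: list_of_vec_index)

section \<open>Lower bounds for linear programming\<close>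

lemma lin_unit: "i < n \<Longrightarrow> x \<in> carrier_vec n \<Longrightarrow> lin (k \<cdot>\<^sub>v unit_vec n i) x = of_rat k * x $ i"
proof -
  assume *: "i < n" "x \<in> carrier_vec n"
  have "map_vec of_rat (k \<cdot>\<^sub>v unit_vec n i) = (of_rat k :: real) \<cdot>\<^sub>v unit_vec n i"
    by (rule eq_vecI) (simp_all add: of_rat_mult unit_vec_def)
  then show ?thesis using * by (simp add: lin_def)
qed

lemma lin_zero: "x \<in> carrier_vec n \<Longrightarrow> lin (0\<^sub>v n) x = 0"
proof -
  assume *: "x \<in> carrier_vec n"
  have "map_vec of_rat (0\<^sub>v n) = (0\<^sub>v n :: real vec)"
    by (rule eq_vecI) simp_all
  then show ?thesis using * unfolding lin_def by (simp only: scalar_prod_left_zero)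
qed

lemma vec_ok_unit:
  assumes "rat_bits k \<le> L" and "2 \<le> L"
  shows "vec_ok n L (k \<cdot>\<^sub>v unit_vec n i)"
  using assms by (auto simp: vec_ok_def unit_vec_def)

text \<open>The scheme behind the lower bounds: if two linear programs look alike to depth
  \<open>d\<close> while their correct answers differ within depth \<open>k\<close>, then a run of
  at most \<open>d - k\<close> steps could not tell them apart.\<close>

lemma lp_time_depth_bound:
  assumes "solves_linear_programming lp LP"
    and "vec_ok n L f" "length rs \<le> b" "\<forall>r \<in> set rs. row_ok n L r"
    and "vec_ok n L g" "length qs \<le> b" "\<forall>r \<in> set qs. row_ok n L r"
    and eq: "trunc d (enc_lp (f, rs)) = trunc d (enc_lp (g, qs))"
    and diff: "\<And>r q. lp_answer n f rs r \<Longrightarrow> lp_answer n g qs q \<Longrightarrow>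
      trunc k (enc_lp_result r) \<noteq> trunc k (enc_lp_result q)"
  shows "d < LP n b L + k"
proof (rule ccontr)
  assume *: "\<not> d < LP n b L + k"
  obtain r t where r: "lp_answer n f rs r" "computes lp (enc_lp (f, rs)) (enc_lp_result r) t"
      "t \<le> LP n b L"
    using assms(1-4) unfolding solves_linear_programming_def by blast
  obtain q u where q: "lp_answer n g qs q" "computes lp (enc_lp (g, qs)) (enc_lp_result q) u"
    using assms(1,5-7) unfolding solves_linear_programming_def by blast
  have "trunc (t + k) (enc_lp (f, rs)) = trunc (t + k) (enc_lp (g, qs))"
    by (rule trunc_eq_mono[OF eq]) (use * r(3) in simp)
  then have "trunc k (enc_lp_result r) = trunc k (enc_lp_result q)"
    by (rule computes_trunc[OF r(2) q(2)])
  with diff r(1) q(1) show False by blast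
qed

lemma lp_time_pos:
  assumes "solves_linear_programming lp LP" and "2 \<le> L"
  shows "0 < LP n b L"
proof -
  have "vec_ok n L (0\<^sub>v n)" using assms(2) by (simp add: vec_ok_def)
  then obtain r t where "computes lp (enc_lp (0\<^sub>v n, [])) (enc_lp_result r) t" "t \<le> LP n b L"
    using assms(1) unfolding solves_linear_programming_def
    by (metis empty_iff le0 list.set(1) list.size(3))
  then show ?thesis
    using exec_time_pos unfolding computes_def by fastforce
qed

text \<open>The constraint \<open>0 \<le> -1\<close> has to be told from \<open>x\<^sub>n \<le> -1\<close>, and these differ only in the last
  entry of the coefficient vector.\<close>

lemma lp_time_ge_dimension:
  assumes lp: "solves_linear_programming lp LP" and L: "3 \<le> L" and b: "1 \<le> b"
  shows "n \<le> LP n b L"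
proof (cases n)
  case (Suc m)
  let ?rs = "[(0\<^sub>v n, -1)] :: row list" and ?qs = "[(unit_vec n m, -1)] :: row list"
  have z: "list_of_vec (0\<^sub>v n :: rat vec) = map (\<lambda>_. 0) [0..<m] @ [0]"
    by (simp add: list_of_vec_conv_map Suc)
  have u: "list_of_vec (unit_vec n m :: rat vec) = map (\<lambda>_. 0) [0..<m] @ [1]"
    by (simp add: list_of_vec_conv_map Suc)
  have "trunc m (enc_vec (0\<^sub>v n)) = trunc m (enc_vec (unit_vec n m))"
    unfolding enc_vec_def z u using trunc_enc_list[of "map (\<lambda>_. 0) [0..<m]"] by simp
  \<comment> \<open>The coefficient vector of the constraint lies three levels below the root:
    objective/constraints pair, first list cell, row.\<close>
  then have eq: "trunc (Suc (Suc (Suc m))) (enc_lp (0\<^sub>v n, ?rs)) =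
      trunc (Suc (Suc (Suc m))) (enc_lp (0\<^sub>v n, ?qs))"
    by (simp add: enc_lp_def enc_row_def)
  \<comment> \<open>One level of output is enough here, because only \<open>Infeasible\<close> is
    encoded as \<open>Leaf\<close>.\<close>
  have "Suc (Suc (Suc m)) < LP n b L + 1"
  proof (rule lp_time_depth_bound[OF lp _ _ _ _ _ _ eq])
    show "vec_ok n L (0\<^sub>v n)" "vec_ok n L (0\<^sub>v n)" using L by (simp_all add: vec_ok_def)
    show "\<forall>r\<in>set ?rs. row_ok n L r"
      using L by (simp add: row_ok_def vec_ok_def)
    show "\<forall>r\<in>set ?qs. row_ok n L r"
      using L Suc by (simp add: row_ok_def vec_ok_def)
    fix r q
    assume r: "lp_answer n (0\<^sub>v n) ?rs r" and q: "lp_answer n (0\<^sub>v n) ?qs q"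
    have "feasible_set n ?rs = {}"
      by (auto simp: feasible_set_def lin_zero)
    then have "r = Infeasible" using r by (cases r) auto
    have "lin (unit_vec n m) ((-1) \<cdot>\<^sub>v unit_vec n m) = -1"
      using lin_unit[of m n "(-1) \<cdot>\<^sub>v unit_vec n m" 1] Suc by simp
    then have "(-1) \<cdot>\<^sub>v unit_vec n m \<in> feasible_set n ?qs"
      by (simp add: feasible_set_def)
    then have "q \<noteq> Infeasible" using q by auto
    then show "trunc 1 (enc_lp_result r) \<noteq> trunc 1 (enc_lp_result q)"
      using \<open>r = Infeasible\<close> by (cases q) auto
  qed (use b in auto)
  then show ?thesis using Suc by simp
qed simp

text \<open>The feasible set is the half-space where the first coordinate is at most
  \<open>v / k\<close>. The bound is attained at a multiple of the first unit vector, which forces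
  the solver's answer.\<close>

lemma lp_answer_single_bound:
  assumes "0 < n" and "0 < k" and "0 \<le> v"
    and "lp_answer n (unit_vec n 0) [(k \<cdot>\<^sub>v unit_vec n 0, v)] r"
  shows "r = Optimum (v / k)"
proof -
  let ?F = "feasible_set n [(k \<cdot>\<^sub>v unit_vec n 0, v)]"
  have k: "(of_rat k :: real) > 0" using assms(2) by simp
  have F: "?F = {x \<in> carrier_vec n. x $ 0 \<le> of_rat (v / k)}"
    using assms(1) k by (auto simp: feasible_set_def lin_unit of_rat_divide field_simps)
  have l: "lin (unit_vec n 0) x = x $ 0" if "x \<in> carrier_vec n" for x
    using lin_unit[of 0 n x 1] that assms(1) by simp
  let ?x = "of_rat (v / k) \<cdot>\<^sub>v unit_vec n 0 :: real vec"
  have x: "?x \<in> ?F" "lin (unit_vec n 0) ?x = of_rat (v / k)"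
    using assms(1) by (simp_all add: F l)
  show ?thesis
  proof (cases r)
    case Infeasible
    then show ?thesis using assms(4) x by auto
  next
    case Unbounded
    have "bdd_above (lin (unit_vec n 0) ` ?F)"
      by (rule bdd_aboveI[of _ "of_rat (v / k)"]) (auto simp: F l)
    then show ?thesis using assms(4) Unbounded by simp
  next
    case (Optimum w)
    then obtain y where "y \<in> ?F" "lin (unit_vec n 0) y = of_rat w"
      and "\<forall>x \<in> ?F. lin (unit_vec n 0) x \<le> of_rat w"
      using assms(4) by auto
    moreover from this(3) x have "of_rat (v / k) \<le> (of_rat w :: real)" by metis
    ultimately have "of_rat w \<le> (of_rat (v / k) :: real)" "of_rat (v / k) \<le> (of_rat w :: real)"
      by (auto simp: F l)
    then have "w = v / k" by (simp add: of_rat_less_eq)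
    then show ?thesis using Optimum by simp
  qed
qed

text \<open>The optimum of \<open>x\<^sub>1\<close> subject to \<open>a x\<^sub>1 \<le> b\<close> is \<open>b / a\<close> in lowest terms, and the top of its encoding
  already reveals whether \<open>a = b\<close>. The values \<open>2\<^sup>k - 1\<close> and \<open>2\<^sup>k\<^sup>+\<^sup>1 - 1\<close> of \<open>b\<close> share their
  first \<open>k\<close> bits.\<close>

lemma lp_time_ge_bits:
  assumes lp: "solves_linear_programming lp LP" and n: "0 < n" and b: "1 \<le> b"
  shows "L \<le> LP n b L + 3"
proof (cases "4 \<le> L")
  case True
  \<comment> \<open>With this choice the larger right-hand side, \<open>2 ^ Suc k - 1\<close>, takes
    exactly \<open>L\<close> bits as a rational.\<close>
  define k where "k = L - 3"
  have k: "L = k + 3" "1 \<le> k" using True by (simp_all add: k_def)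
  define N where "N j = (2 ^ j - 1 :: nat)" for j
  let ?q = "\<lambda>j. of_int (int (N j)) :: rat"
  let ?rs = "\<lambda>j. [(?q k \<cdot>\<^sub>v unit_vec n 0, ?q j)]"
  have bits: "nat_bits (N j) = replicate j True" for j
    unfolding N_def by (rule nat_bits_mask)
  have enc: "enc_rat (?q j) = Node (Node Leaf (enc_nat (N j))) (enc_nat 1)" for j
    unfolding enc_rat_of_int by simp
  have size: "rat_bits (?q j) = j + 2" for j
    unfolding rat_bits_of_int by (simp add: bits)
  have "enc_nat (N (Suc k)) = enc_list enc_bool (replicate k True @ [True])"
    unfolding enc_nat_def bits by (simp add: replicate_append_same)
  moreover have "enc_nat (N k) = enc_list enc_bool (replicate k True @ [])"
    unfolding enc_nat_def bits by simp
  ultimately have "trunc k (enc_nat (N k)) = trunc k (enc_nat (N (Suc k)))"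
    using trunc_enc_list[of "replicate k True" enc_bool "[]" "[True]"] by simp
  \<comment> \<open>Five levels lead from the root to the numerator's bits: pair, list cell, row,
    fraction, signed integer. Below that the first \<open>k\<close> cells agree.\<close>
  then have eq: "trunc (Suc (Suc (Suc (Suc (Suc k))))) (enc_lp (unit_vec n 0, ?rs k)) =
      trunc (Suc (Suc (Suc (Suc (Suc k))))) (enc_lp (unit_vec n 0, ?rs (Suc k)))"
    by (simp add: enc_lp_def enc_row_def enc del: of_int_of_nat_eq)
  have ok: "row_ok n L (?q k \<cdot>\<^sub>v unit_vec n 0, ?q j)" if "j \<le> Suc k" for j
    using vec_ok_unit[of "?q k" L n 0] size[of k] size[of j] that k by (simp add: row_ok_def)
  have "Suc (Suc (Suc (Suc (Suc k)))) < LP n b L + Suc (Suc (Suc (Suc (Suc 0))))"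
  proof (rule lp_time_depth_bound[OF lp _ _ _ _ _ _ eq])
    show "vec_ok n L (unit_vec n 0)" "vec_ok n L (unit_vec n 0)"
      using vec_ok_unit[of 1 L n 0] k by simp_all
    show "\<forall>r\<in>set (?rs k). row_ok n L r" "\<forall>r\<in>set (?rs (Suc k)). row_ok n L r"
      using ok by (simp_all del: of_int_of_nat_eq)
    fix r q
    assume r: "lp_answer n (unit_vec n 0) (?rs k) r"
      and q: "lp_answer n (unit_vec n 0) (?rs (Suc k)) q"
    have "(2::nat) ^ 1 \<le> 2 ^ k" using k(2) by (intro power_increasing) auto
    then have Npos: "0 < N k" and Nlt: "N k < N (Suc k)" by (simp_all add: N_def)
    \<comment> \<open>The quotient 1 is written as \<open>of_int 1\<close> so that
      \<open>enc_rat_of_int\<close> can compute its encoding.\<close>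
    have r: "r = Optimum (of_int 1)"
      using lp_answer_single_bound[OF n _ _ r] Npos by simp
    have q: "q = Optimum (?q (Suc k) / ?q k)"
      using lp_answer_single_bound[OF n _ _ q] Npos by simp
    obtain z w where zw: "quotient_of (?q (Suc k) / ?q k) = (z, w)" by fastforce
    \<comment> \<open>Two levels reveal whether a bit list has exactly one cell, and 1 is the only
      number with a one-bit expansion. Five levels of the result show at least this much of
      numerator and denominator.\<close>
    have one: "m = 1" if m: "trunc (Suc (Suc 0)) (enc_nat m) = trunc (Suc (Suc 0)) (enc_nat 1)" for m
    proof -
      obtain x xs where "nat_bits m = x # xs" "xs = []"
        using m by (cases "nat_bits m"; cases "tl (nat_bits m)") (auto simp: enc_nat_def)
      moreover have "m > 0" using calculation by (cases "m = 0") auto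
      ultimately have "m div 2 = 0" "m > 0" by (auto simp: nat_bits_pos)
      then show ?thesis by simp
    qed
    show "trunc (Suc (Suc (Suc (Suc (Suc 0))))) (enc_lp_result r) \<noteq>
        trunc (Suc (Suc (Suc (Suc (Suc 0))))) (enc_lp_result q)"
    proof
      assume "trunc (Suc (Suc (Suc (Suc (Suc 0))))) (enc_lp_result r) =
        trunc (Suc (Suc (Suc (Suc (Suc 0))))) (enc_lp_result q)"
      then have *: "trunc (Suc (Suc 0)) (enc_nat (nat \<bar>z\<bar>)) = trunc (Suc (Suc 0)) (enc_nat 1)"
        "trunc (Suc (Suc (Suc 0))) (enc_nat (nat w)) = trunc (Suc (Suc (Suc 0))) (enc_nat 1)"
        unfolding r q enc_lp_result.simps enc_rat_of_int
        by (simp_all add: enc_rat_def zw enc_int_def del: of_int_of_nat_eq)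
      have "nat \<bar>z\<bar> = 1" by (rule one[OF *(1)])
      moreover have "nat w = 1" by (rule one[OF trunc_eq_mono[OF *(2)]]) simp
      ultimately have "z = 1 \<or> z = -1" "w = 1" by auto
      moreover have "?q (Suc k) / ?q k = of_int z / of_int w"
        by (rule quotient_of_div[OF zw])
      ultimately have "?q (Suc k) / ?q k = 1 \<or> ?q (Suc k) / ?q k = -1" by auto
      then have "?q (Suc k) = ?q k \<or> ?q (Suc k) = - ?q k"
        using Npos by (auto simp: field_simps)
      moreover have "?q (Suc k) > ?q k" "?q k > 0" using Nlt Npos by simp_all
      ultimately show False by auto
    qed
  qed (use b in auto)
  then show ?thesis using k by simp
qed simp

section \<open>Correctness of the elimination procedure\<close>

lemma lin_combination:
  assumes "a \<in> carrier_vec n" "x \<in> carrier_vec n" "y \<in> carrier_vec n"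
  shows "lin a ((1 - t) \<cdot>\<^sub>v x + t \<cdot>\<^sub>v y) = (1 - t) * lin a x + t * lin a y"
  using assms unfolding lin_def
  by (simp add: scalar_prod_add_distrib[of _ n] scalar_prod_smult_distrib[of _ n])

lemma lin_uminus:
  assumes "a \<in> carrier_vec n" "x \<in> carrier_vec n"
  shows "lin (- a) x = - lin a x"
proof -
  have "map_vec of_rat (- a) = (- map_vec of_rat a :: real vec)"
    by (rule eq_vecI) (simp_all add: of_rat_minus)
  then show ?thesis using assms by (simp add: lin_def)
qed

lemma feasible_set_carrier: "x \<in> feasible_set n rs \<Longrightarrow> x \<in> carrier_vec n"
  by (simp add: feasible_set_def)

lemma feasible_set_convex:
  assumes rs: "\<forall>(a, b) \<in> set rs. a \<in> carrier_vec n"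
    and x: "x \<in> feasible_set n rs" and y: "y \<in> feasible_set n rs" and t: "0 \<le> t" "t \<le> 1"
  shows "(1 - t) \<cdot>\<^sub>v x + t \<cdot>\<^sub>v y \<in> feasible_set n rs"
proof -
  have "lin a ((1 - t) \<cdot>\<^sub>v x + t \<cdot>\<^sub>v y) \<le> of_rat b" if "(a, b) \<in> set rs" for a b
  proof -
    have "lin a ((1 - t) \<cdot>\<^sub>v x + t \<cdot>\<^sub>v y) = (1 - t) * lin a x + t * lin a y"
      using that rs x y by (intro lin_combination[of _ n]) (auto dest: feasible_set_carrier)
    also have "\<dots> \<le> (1 - t) * of_rat b + t * of_rat b"
      using that x y t by (intro add_mono mult_left_mono) (auto simp: feasible_set_def)
    finally show ?thesis by (simp add: algebra_simps)
  qed
  then show ?thesis using x y by (auto simp: feasible_set_def)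
qed

text \<open>Along a segment each hyperplane that misses one of the endpoints is met at most once.\<close>

lemma feasible_set_avoids_hyperplanes:
  assumes "finite S" and rs: "\<forall>(a, b) \<in> set rs. a \<in> carrier_vec n"
    and "feasible_set n rs \<noteq> {}"
    and "\<forall>(a, b) \<in> S. a \<in> carrier_vec n \<and> (\<exists>x \<in> feasible_set n rs. lin a x \<noteq> of_rat b)"
  shows "\<exists>x \<in> feasible_set n rs. \<forall>(a, b) \<in> S. lin a x \<noteq> of_rat b"
  using assms(1,3,4)
proof (induction S rule: finite_induct)
  case empty
  then show ?case by auto
next
  case (insert r S)
  obtain a b where r: "r = (a, b)" by fastforce
  obtain x where x: "x \<in> feasible_set n rs" "\<forall>(a, b) \<in> S. lin a x \<noteq> of_rat b"
    using insert.IH[OF insert.prems(1)] insert.prems(2) by blast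
  obtain y where y: "y \<in> feasible_set n rs" "lin a y \<noteq> of_rat b"
    using insert.prems(2) r by auto
  define z where "z t = (1 - t) \<cdot>\<^sub>v x + t \<cdot>\<^sub>v y" for t :: real
  have bad: "finite {t. lin c (z t) = of_rat d}" if "(c, d) \<in> insert r S" for c d
  proof -
    have c: "c \<in> carrier_vec n" using that insert.prems(2) by auto
    \<comment> \<open>The old hyperplanes miss \<open>x\<close> by the induction hypothesis, the new
      one misses \<open>y\<close>. Since \<open>lin c (z t)\<close> is affine in \<open>t\<close>,
      it takes the value \<open>d\<close> for at most one parameter.\<close>
    have "lin c x \<noteq> of_rat d \<or> lin c y \<noteq> of_rat d"
      using that x(2) y(2) r by auto
    then have "t = (of_rat d - lin c x) / (lin c y - lin c x)" if "lin c (z t) = of_rat d" for t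
    proof -
      have *: "t * (lin c y - lin c x) = of_rat d - lin c x"
        using that lin_combination[OF c x(1)[THEN feasible_set_carrier] y(1)[THEN feasible_set_carrier], of t]
        unfolding z_def by (simp add: left_diff_distrib right_diff_distrib)
      moreover have "lin c y - lin c x \<noteq> 0"
      proof
        assume "lin c y - lin c x = 0"
        with * \<open>lin c x \<noteq> of_rat d \<or> lin c y \<noteq> of_rat d\<close> show False by simp
      qed
      ultimately show ?thesis by (rule nonzero_eq_divide_eq[THEN iffD2, rotated])
    qed
    then have "{t. lin c (z t) = of_rat d} \<subseteq> {(of_rat d - lin c x) / (lin c y - lin c x)}"
      by blast
    then show ?thesis by (rule finite_subset) simp
  qed
  \<comment> \<open>Finitely many bad parameters cannot exhaust the infinite interval from 0 to
    1.\<close>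
  have "finite (\<Union>(c, d) \<in> insert r S. {t. lin c (z t) = of_rat d})"
    using insert.hyps(1) bad by (intro finite_UN_I) auto
  moreover have "infinite {0..1::real}" by (simp add: infinite_Icc)
  ultimately have "\<not> {0..1} \<subseteq> (\<Union>(c, d) \<in> insert r S. {t. lin c (z t) = of_rat d})"
    by (intro notI) (drule (1) finite_subset, simp)
  then obtain t where "t \<in> {0..1}"
    and not_bad: "t \<notin> (\<Union>(c, d) \<in> insert r S. {t. lin c (z t) = of_rat d})"
    by (meson subsetI)
  then have t: "0 \<le> t" "t \<le> 1" by simp_all
  have "lin c (z t) \<noteq> of_rat d" if "(c, d) \<in> insert r S" for c d
    using not_bad that by (auto simp del: insert_iff)
  then have "\<forall>(c, d) \<in> insert r S. lin c (z t) \<noteq> of_rat d" by (intro ballI) (simp add: split_paired_all)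
  moreover have "z t \<in> feasible_set n rs"
    unfolding z_def by (rule feasible_set_convex[OF rs x(1) y(1) t])
  ultimately show ?case by (rule bexI)
qed

section \<open>Containment in affine subspaces via linear programs\<close>

definition contained :: "nat \<Rightarrow> row list \<Rightarrow> row list \<Rightarrow> bool" where
  "contained n rs eqs \<longleftrightarrow> (\<forall>x \<in> feasible_set n rs. \<forall>(a, b) \<in> set eqs. lin a x = of_rat b)"

lemma contained_Nil [simp]: "contained n rs []"
  by (simp add: contained_def)

text \<open>The solver may return any correct answer; this shows that once an optimum exists only
  one answer is correct, so it can be compared with the expected value.\<close>

lemma lp_answer_Optimum_unique:
  assumes "lp_answer n f rs (Optimum v)" and "lp_answer n f rs res"
  shows "res = Optimum v"
proof -
  obtain x where x: "x \<in> feasible_set n rs" "lin f x = of_rat v"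
    and max: "\<forall>y \<in> feasible_set n rs. lin f y \<le> of_rat v"
    using assms(1) by auto
  show ?thesis
  proof (cases res)
    case Infeasible
    then show ?thesis using assms(2) x by simp
  next
    case Unbounded
    have "bdd_above (lin f ` feasible_set n rs)"
      using max by (intro bdd_aboveI[of _ "of_rat v"]) auto
    then show ?thesis using assms(2) Unbounded by simp
  next
    case (Optimum w)
    then obtain y where y: "y \<in> feasible_set n rs" "lin f y = of_rat w"
      and max': "\<forall>y \<in> feasible_set n rs. lin f y \<le> of_rat w"
      using assms(2) by auto
    have "(of_rat w :: real) = of_rat v"
      using bspec[OF max y(1)] bspec[OF max' x(1)] x(2) y(2) by simp
    then show ?thesis using Optimum by simp
  qed
qed

text \<open>The condition under which a single solver call passes the test; an infeasible program
  passes because containment is then vacuous.\<close>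

definition max_is :: "nat \<Rightarrow> row list \<Rightarrow> row \<Rightarrow> bool" where
  "max_is n rs r \<longleftrightarrow> feasible_set n rs = {} \<or> lp_answer n (fst r) rs (Optimum (snd r))"

text \<open>Serves two purposes: it gives the second objective for testing an equation, and, read as
  a constraint, it turns \<open>c x < d\<close> into its complement
  \<open>c x \<ge> d\<close>.\<close>

definition neg_row :: "row \<Rightarrow> row" where
  "neg_row r = (- fst r, - snd r)"

lemma row_ok_neg_row: "row_ok n L r \<Longrightarrow> row_ok n L (neg_row r)"
  by (auto simp: row_ok_def vec_ok_def neg_row_def)

text \<open>The maxima of \<open>a x\<close> and \<open>- a x\<close> bound \<open>a x\<close> from
  above and below by \<open>b\<close>. Conversely, a function constantly equal to \<open>b\<close>
  on a non-empty set attains both maxima.\<close>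

lemma contained_Cons:
  assumes "fst r \<in> carrier_vec n"
  shows "contained n rs (r # eqs) \<longleftrightarrow>
    max_is n rs r \<and> max_is n rs (neg_row r) \<and> contained n rs eqs"
proof -
  obtain a b where r: "r = (a, b)" by fastforce
  have neg: "lin (- a) x = - lin a x" if "x \<in> feasible_set n rs" for x
    using that assms r by (intro lin_uminus[of _ n]) (auto dest: feasible_set_carrier)
  have "(\<forall>x \<in> feasible_set n rs. lin a x = of_rat b) \<longleftrightarrow> max_is n rs r \<and> max_is n rs (neg_row r)"
    (is "?L \<longleftrightarrow> ?R")
  proof
    assume ?L
    then show ?R by (auto simp: max_is_def neg_row_def r neg of_rat_minus)
  next
    assume R: ?R
    show ?L
    proof
      fix x assume x: "x \<in> feasible_set n rs"
      then have "lin a x \<le> of_rat b" "lin (- a) x \<le> of_rat (- b)"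
        using R by (auto simp: max_is_def neg_row_def r)
      then show "lin a x = of_rat b" using neg[OF x] by (simp add: of_rat_minus)
    qed
  qed
  then show ?thesis by (auto simp: contained_def r)
qed

text \<open>\<open>rs\<close> are the constraints derived so far and \<open>pend\<close> are the sets not yet turned into
  constraints.\<close>

definition elim_inv :: "nat \<Rightarrow> nat \<Rightarrow> block list \<Rightarrow> row list \<Rightarrow> block list \<Rightarrow> bool" where
  "elim_inv n L Bs rs pend \<longleftrightarrow>
    length rs + length pend = length Bs \<and> set pend \<subseteq> set Bs \<and> (\<forall>r \<in> set rs. row_ok n L r) \<and>
    carrier_vec n - (\<Union>B \<in> set Bs. block_set n B) \<subseteq> feasible_set n rs \<and>
    (\<forall>B \<in> set Bs. B \<in> set pend \<or> block_set n B \<inter> feasible_set n rs = {})"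

lemma elim_instanceD:
  assumes "elim_instance n L Bs" and "(eqs, r) \<in> set Bs"
  shows "\<forall>q \<in> set eqs. row_ok n L q" and "row_ok n L r" and "block_set n (eqs, r) \<noteq> {}"
  using bspec[OF conjunct2[OF assms(1)[unfolded elim_instance_def]] assms(2)] by simp_all

lemma elim_inv_init: "elim_inv n L Bs [] Bs"
  by (auto simp: elim_inv_def feasible_set_def)

text \<open>Setting a set aside is harmless, as the invariant sees only the elements and the length
  of the pending list.\<close>

lemma elim_inv_rotate:
  "elim_inv n L Bs rs ((B # todo) @ rest) \<Longrightarrow> elim_inv n L Bs rs (todo @ B # rest)"
  by (auto simp: elim_inv_def)

text \<open>A point of the complement lies in the current polyhedron and so satisfies the equations
  of this set; being outside the set, it must violate the strict inequality. The new constraint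
  therefore loses no such point and makes the set disjoint from the polyhedron.\<close>

lemma elim_inv_add:
  assumes inst: "elim_instance n L Bs" and inv: "elim_inv n L Bs rs (((eqs, r) # todo) @ rest)"
    and "contained n rs eqs"
  shows "elim_inv n L Bs (neg_row r # rs) (todo @ rest)"
proof -
  obtain c d where r: "r = (c, d)" by fastforce
  have B: "(eqs, r) \<in> set Bs" using inv by (simp add: elim_inv_def)
  then have ok: "row_ok n L r" by (rule elim_instanceD[OF inst])
  then have c: "c \<in> carrier_vec n" by (simp add: row_ok_def vec_ok_def r)
  have F: "feasible_set n (neg_row r # rs) = {x \<in> feasible_set n rs. of_rat d \<le> lin c x}"
    using c by (auto simp: feasible_set_def neg_row_def r of_rat_minus lin_uminus[of _ n])
  have block: "block_set n (eqs, r) \<inter> feasible_set n (neg_row r # rs) = {}"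
    unfolding F by (auto simp: r)
  have "x \<in> feasible_set n (neg_row r # rs)"
    if x: "x \<in> carrier_vec n - (\<Union>B \<in> set Bs. block_set n B)" for x
  proof -
    have xF: "x \<in> feasible_set n rs" using x inv by (auto simp: elim_inv_def)
    then have "\<forall>(a, b) \<in> set eqs. lin a x = of_rat b"
      using assms(3) by (auto simp: contained_def)
    moreover have "x \<notin> block_set n (eqs, r)" using x B by blast
    ultimately have "of_rat d \<le> lin c x" using x by (auto simp: r)
    then show ?thesis using xF by (simp add: F)
  qed
  then have "carrier_vec n - (\<Union>B \<in> set Bs. block_set n B) \<subseteq> feasible_set n (neg_row r # rs)"
    by (rule subsetI)
  moreover have "B \<in> set (todo @ rest) \<or> block_set n B \<inter> feasible_set n (neg_row r # rs) = {}"
    if "B \<in> set Bs" for B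
  proof (cases "B = (eqs, r)")
    case False
    then have "B \<in> set (todo @ rest) \<or> block_set n B \<inter> feasible_set n rs = {}"
      using inv that unfolding elim_inv_def by (simp, blast)
    then show ?thesis unfolding F by blast
  qed (simp only: block simp_thms)
  ultimately show ?thesis
    using inv row_ok_neg_row[OF ok] by (simp add: elim_inv_def)
qed

text \<open>Every stuck set has an equation that fails somewhere on the polyhedron. Choosing one
  such hyperplane per set, a non-empty polyhedron has a point off all of them; it lies in no pending
  set, and the invariant keeps it out of the treated ones.\<close>

lemma elim_inv_final:
  assumes inst: "elim_instance n L Bs" and inv: "elim_inv n L Bs rs pend"
    and stuck: "\<forall>B \<in> set pend. \<not> contained n rs (fst B)"
  shows "carrier_vec n - (\<Union>B \<in> set Bs. block_set n B) = {} \<longleftrightarrow> feasible_set n rs = {}"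
proof
  assume "feasible_set n rs = {}"
  then show "carrier_vec n - (\<Union>B \<in> set Bs. block_set n B) = {}"
    using inv by (auto simp: elim_inv_def)
next
  assume empty: "carrier_vec n - (\<Union>B \<in> set Bs. block_set n B) = {}"
  show "feasible_set n rs = {}"
  proof (rule ccontr)
    assume ne: "feasible_set n rs \<noteq> {}"
    have "\<forall>B \<in> set pend. \<exists>r. r \<in> set (fst B) \<and> (\<exists>x \<in> feasible_set n rs. lin (fst r) x \<noteq> of_rat (snd r))"
      using stuck unfolding contained_def case_prod_beta by blast
    from bchoice[OF this] obtain g where g: "\<And>B. B \<in> set pend \<Longrightarrow> g B \<in> set (fst B) \<and>
        (\<exists>x \<in> feasible_set n rs. lin (fst (g B)) x \<noteq> of_rat (snd (g B)))"
      by blast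
    have row: "row_ok n L r" if "B \<in> set Bs" "r \<in> set (fst B)" for B r
      using that elim_instanceD(1)[OF inst, of "fst B" "snd B"] by simp
    have "\<exists>x \<in> feasible_set n rs. \<forall>(a, b) \<in> g ` set pend. lin a x \<noteq> of_rat b"
    proof (rule feasible_set_avoids_hyperplanes)
      show "\<forall>(a, b) \<in> set rs. a \<in> carrier_vec n"
        using inv by (auto simp: elim_inv_def row_ok_def vec_ok_def)
      show "\<forall>(a, b) \<in> g ` set pend. a \<in> carrier_vec n \<and> (\<exists>x \<in> feasible_set n rs. lin a x \<noteq> of_rat b)"
      proof clarify
        fix a b B assume B: "(a, b) = g B" "B \<in> set pend"
        then have "B \<in> set Bs" using inv by (auto simp: elim_inv_def)
        then have "row_ok n L (a, b)" using row g[OF B(2)] B(1) by simp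
        then show "a \<in> carrier_vec n \<and> (\<exists>x \<in> feasible_set n rs. lin a x \<noteq> of_rat b)"
          using g[OF B(2)] B(1)[symmetric] by (simp add: row_ok_def vec_ok_def)
      qed
    qed (use ne in simp_all)
    then obtain x where x: "x \<in> feasible_set n rs"
      and avoid: "\<forall>(a, b) \<in> g ` set pend. lin a x \<noteq> of_rat b"
      by blast
    obtain B where B: "B \<in> set Bs" "x \<in> block_set n B"
      using empty feasible_set_carrier[OF x] by blast
    then have pend: "B \<in> set pend" using inv x unfolding elim_inv_def by blast
    obtain eqs c d where Beq: "B = (eqs, (c, d))" by (metis surj_pair)
    have "lin (fst (g B)) x \<noteq> of_rat (snd (g B))"
      using avoid pend unfolding case_prod_beta by blast
    moreover have "\<forall>r \<in> set (fst B). lin (fst r) x = of_rat (snd r)"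
      using B(2) unfolding Beq by (simp add: case_prod_beta)
    ultimately show False using g[OF pend] by blast
  qed
qed

text \<open>With at most two bits every number is 0, and \<open>0 x < 0\<close> has no solution,
  contrary to the non-emptiness of the sets. This supplies the bit assumption of the solver lower
  bounds.\<close>

lemma elim_instance_bits_ge_3:
  assumes "elim_instance n L Bs"
  shows "3 \<le> L"
proof (rule ccontr)
  assume L: "\<not> 3 \<le> L"
  obtain eqs c d where B: "(eqs, (c, d)) \<in> set Bs"
    using assms unfolding elim_instance_def by (metis list.set_intros(1) neq_Nil_conv surj_pair)
  note ok = elim_instanceD(2)[OF assms B] and ne = elim_instanceD(3)[OF assms B]
  have "q = 0" if "rat_bits q \<le> L" for q
    using that L by (intro rat_bits_le_2D) simp
  then have "c = 0\<^sub>v n" "d = 0"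
    using ok by (auto simp: row_ok_def vec_ok_def intro!: eq_vecI)
  with ne show False by (auto simp: lin_zero)
qed

section \<open>The program\<close>

text \<open>Counts the pairs of subtrees met when two trees are compared in lockstep. Being bounded
  by the smaller tree, it is not affected by a solver answer that is longer than the number it is
  compared with.\<close>

fun common_size :: "tree \<Rightarrow> tree \<Rightarrow> nat" where
  "common_size (Node a b) (Node c d) = 1 + common_size a c + common_size b d"
| "common_size _ _ = 1"

lemma common_size_le: "common_size x y \<le> tree_size x" "common_size x y \<le> tree_size y"
proof -
  have "1 \<le> tree_size z" for z by (cases z) auto
  then show "common_size x y \<le> tree_size x" "common_size x y \<le> tree_size y"
    by (induction x y rule: common_size.induct) auto
qed

text \<open>The solver is specified on a store that is empty apart from its input, so its variables
  are reset before every call.\<close>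

fun clear_vars :: "nat \<Rightarrow> com" where
  "clear_vars 0 = Assign 0 ENil"
| "clear_vars (Suc k) = Seq (Assign (Suc k) ENil) (clear_vars k)"

lemma wp_clear_vars:
  "wp (clear_vars k) s Q \<longleftrightarrow> Q (2 * k + 2) (\<lambda>x. if x \<le> k then Leaf else s x)"
proof (induction k arbitrary: s Q)
  case 0
  have "s(0 := Leaf) = (\<lambda>x. if x \<le> 0 then Leaf else s x)" by auto
  then show ?case by (simp add: numeral_2_eq_2)
next
  case (Suc k)
  have "(\<lambda>x. if x \<le> k then Leaf else (s(Suc k := Leaf)) x) =
      (\<lambda>x. if x \<le> Suc k then Leaf else s x)"
    by (auto simp: fun_eq_iff)
  with Suc show ?case by simp
qed

lemma modified_clear_vars: "modified (clear_vars k) \<subseteq> {..k}"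
  by (induction k) auto

lemma enc_rat_parts:
  assumes "quotient_of q = (z, w)"
  shows "enc_rat q = Node (Node (enc_bool (z < 0)) (enc_nat (nat \<bar>z\<bar>))) (enc_nat (nat w))"
    and "enc_rat (- q) = Node (Node (enc_bool (0 < z)) (enc_nat (nat \<bar>z\<bar>))) (enc_nat (nat w))"
  using assms by (simp_all add: enc_rat_def enc_int_def rat_uminus_code)

lemma enc_row_simp: "enc_row r = Node (enc_vec (fst r)) (enc_rat (snd r))"
  by (cases r) (simp add: enc_row_def)

lemma enc_vec_uminus: "enc_vec (- a) = enc_list enc_rat (map uminus (list_of_vec a))"
proof -
  have "list_of_vec (- a) = map uminus (list_of_vec a)"
    by (simp add: list_of_vec_conv_map)
  then show ?thesis by (simp add: enc_vec_def)
qed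

text \<open>The program keeps its own variables above \<open>N\<close>, out of reach of the linear programming solver.\<close>

locale lp_solver =
  fixes lp :: com and LP :: "nat \<Rightarrow> nat \<Rightarrow> nat \<Rightarrow> nat" and N :: nat
  assumes lp: "solves_linear_programming lp LP" and lp_vars: "com_vars lp \<subseteq> {..N}"
begin

text \<open>\<open>vRS\<close> holds the derived constraints, \<open>vTODO\<close> the sets still to
  be scanned in a round, \<open>vREST\<close> those set aside, and \<open>vNEW\<close> records
  whether the round has added a constraint. \<open>vOK\<close> starts true for each set and is
  cleared by a failed test.\<close>

abbreviation "vROW \<equiv> N + 3"
abbreviation "vRS \<equiv> N + 4"
abbreviation "vOK \<equiv> N + 5"
abbreviation "vEQS \<equiv> N + 6"
abbreviation "vTODO \<equiv> N + 7"
abbreviation "vREST \<equiv> N + 8"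
abbreviation "vNEW \<equiv> N + 9"
abbreviation "vSTACK \<equiv> N + 10"
abbreviation "vTMP \<equiv> N + 11"
abbreviation "vREV \<equiv> N + 12"
abbreviation "vRAT \<equiv> N + 13"
abbreviation "vOBJ \<equiv> N + 14"
abbreviation "ETrue \<equiv> ECons ENil ENil"

section \<open>Negating rationals and rows\<close>

text \<open>The outer test asks for a non-zero numerator: zero always carries the sign
  \<open>False\<close>, and flipping it would give a tree that encodes no rational. Assigning
  \<open>vRAT\<close> to itself acts as a skip.\<close>

definition neg_rat_com :: com where
  "neg_rat_com =
    Cond (ETl (EHd (EVar vRAT)))
      (Cond (EHd (EHd (EVar vRAT)))
        (Assign vRAT (ECons (ECons ENil (ETl (EHd (EVar vRAT)))) (ETl (EVar vRAT))))
        (Assign vRAT (ECons (ECons ETrue (ETl (EHd (EVar vRAT)))) (ETl (EVar vRAT)))))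
      (Assign vRAT (EVar vRAT))"

lemma wp_neg_rat:
  assumes "s vRAT = enc_rat q" and "\<And>t. t \<le> 25 \<Longrightarrow> Q t (s(vRAT := enc_rat (- q)))"
  shows "wp neg_rat_com s Q"
proof -
  obtain z w where z: "quotient_of q = (z, w)" by fastforce
  note enc = enc_rat_parts[OF z]
  consider "z = 0" | "z < 0" | "z > 0" by linarith
  then show ?thesis
  proof cases
    case 1
    then have "enc_rat (- q) = s vRAT" using enc assms(1) by simp
    then show ?thesis using 1 assms enc by (simp add: neg_rat_com_def)
  next
    case 2
    then show ?thesis using assms enc by (simp add: neg_rat_com_def)
  next
    case 3
    then show ?thesis using assms enc by (simp add: neg_rat_com_def)
  qed
qed

text \<open>Lists are consumed from the front, so the negated entries pile up in reverse order and a
  second loop restores the order.\<close>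

definition neg_loop_body :: com where
  "neg_loop_body = Seq (Assign vRAT (EHd (EVar vTMP))) (Seq neg_rat_com
    (Seq (Assign vREV (ECons (EVar vRAT) (EVar vREV))) (Assign vTMP (ETl (EVar vTMP)))))"

abbreviation "neg_loop \<equiv> While (EVar vTMP) neg_loop_body"

lemma wp_neg_loop:
  assumes "s vTMP = enc_list enc_rat qs" and "s vREV = enc_list enc_rat ps"
  shows "wp neg_loop s (\<lambda>t s'. s' vREV = enc_list enc_rat (rev (map uminus qs) @ ps) \<and>
    s' vTMP = Leaf \<and> t \<le> 50 * length qs + 2)"
  using assms
proof (induction qs arbitrary: s ps)
  case Nil
  then show ?case by (simp add: wp_While_Leaf)
next
  case (Cons q qs)
  have "eval_exp (EVar vTMP) s \<noteq> Leaf" using Cons.prems by simp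
  moreover have "wp neg_loop_body s (\<lambda>t s'. s' vREV = enc_list enc_rat ((- q) # ps) \<and>
      s' vTMP = enc_list enc_rat qs \<and> t \<le> 45)"
    unfolding neg_loop_body_def wp_Seq wp_Assign
    by (rule wp_neg_rat[of _ q]) (use Cons.prems in simp_all)
  ultimately show ?case
  proof (rule wp_WhileI)
    fix t :: nat and s' :: store
    assume s': "s' vREV = enc_list enc_rat ((- q) # ps) \<and> s' vTMP = enc_list enc_rat qs \<and> t \<le> 45"
    show "wp neg_loop s' (\<lambda>u s''. s'' vREV = enc_list enc_rat (rev (map uminus (q # qs)) @ ps) \<and>
        s'' vTMP = Leaf \<and> 1 + exp_time (EVar vTMP) + t + u \<le> 50 * length (q # qs) + 2)"
      by (rule wp_frame[OF Cons.IH[of s' "(- q) # ps"]]) (use s' in simp_all)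
  qed
qed

definition rev_loop_body :: com where
  "rev_loop_body =
    Seq (Assign vTMP (ECons (EHd (EVar vREV)) (EVar vTMP))) (Assign vREV (ETl (EVar vREV)))"

abbreviation "rev_loop \<equiv> While (EVar vREV) rev_loop_body"

lemma wp_rev_loop:
  assumes "s vREV = enc_list enc_rat qs" and "s vTMP = enc_list enc_rat ps"
  shows "wp rev_loop s (\<lambda>t s'. s' vTMP = enc_list enc_rat (rev qs @ ps) \<and> t \<le> 50 * length qs + 2)"
  using assms
proof (induction qs arbitrary: s ps)
  case Nil
  then show ?case by (simp add: wp_While_Leaf)
next
  case (Cons q qs)
  have "eval_exp (EVar vREV) s \<noteq> Leaf" using Cons.prems by simp
  moreover have "wp rev_loop_body s (\<lambda>t s'. s' vTMP = enc_list enc_rat (q # ps) \<and>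
      s' vREV = enc_list enc_rat qs \<and> t \<le> 45)"
    using Cons.prems by (simp add: rev_loop_body_def)
  ultimately show ?case
  proof (rule wp_WhileI)
    fix t :: nat and s' :: store
    assume s': "s' vTMP = enc_list enc_rat (q # ps) \<and> s' vREV = enc_list enc_rat qs \<and> t \<le> 45"
    show "wp rev_loop s' (\<lambda>u s''. s'' vTMP = enc_list enc_rat (rev (q # qs) @ ps) \<and>
        1 + exp_time (EVar vREV) + t + u \<le> 50 * length (q # qs) + 2)"
      by (rule wp_frame[OF Cons.IH[of s' "q # ps"]]) (use s' in simp_all)
  qed
qed

definition neg_row_com :: com where
  "neg_row_com =
    Seq (Seq (Assign vTMP (EHd (EVar vROW))) (Assign vREV ENil)) (Seq neg_loop (Seq rev_loop
    (Seq (Assign vRAT (ETl (EVar vROW))) (Seq neg_rat_com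
    (Assign vROW (ECons (EVar vTMP) (EVar vRAT)))))))"

lemma modified_neg_row_com [simp]: "modified neg_row_com = {vTMP, vREV, vRAT, vROW}"
  by (auto simp: neg_row_com_def neg_loop_body_def rev_loop_body_def neg_rat_com_def)

lemma wp_neg_row:
  assumes "s vROW = enc_row r" and "fst r \<in> carrier_vec n"
  shows "wp neg_row_com s (\<lambda>t s'. s' vROW = enc_row (neg_row r) \<and> t \<le> 100 * n + 60)"
proof -
  let ?qs = "list_of_vec (fst r)"
  have len: "length ?qs = n" using assms(2) by simp
  have row: "s vROW = Node (enc_list enc_rat ?qs) (enc_rat (snd r))"
    using assms(1) by (simp add: enc_row_simp enc_vec_def)
  have neg: "vROW \<notin> modified neg_loop" and rev: "vROW \<notin> modified rev_loop"
    by (auto simp: neg_loop_body_def rev_loop_body_def neg_rat_com_def)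
  show ?thesis
    unfolding neg_row_com_def
  proof (rule wp_SeqI)
    show "wp (Seq (Assign vTMP (EHd (EVar vROW))) (Assign vREV ENil)) s
      (\<lambda>t s'. s' vTMP = enc_list enc_rat ?qs \<and> s' vREV = enc_list enc_rat [] \<and>
        s' vROW = s vROW \<and> t = 5)"
      using row by simp
  next
    fix t1 :: nat and s1 :: store
    assume s1: "s1 vTMP = enc_list enc_rat ?qs \<and> s1 vREV = enc_list enc_rat [] \<and>
      s1 vROW = s vROW \<and> t1 = 5"
    show "wp (Seq neg_loop (Seq rev_loop
        (Seq (Assign vRAT (ETl (EVar vROW))) (Seq neg_rat_com
        (Assign vROW (ECons (EVar vTMP) (EVar vRAT))))))) s1
        (\<lambda>u s'. s' vROW = enc_row (neg_row r) \<and> t1 + u \<le> 100 * n + 60)"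
    proof (rule wp_SeqI[OF wp_neg_loop[of s1 ?qs "[]"]])
      fix t2 :: nat and s2 :: store
      assume s2: "s2 vREV = enc_list enc_rat (rev (map uminus ?qs) @ []) \<and>
          s2 vTMP = Leaf \<and> t2 \<le> 50 * length ?qs + 2"
        and f2: "\<forall>x. x \<notin> modified neg_loop \<longrightarrow> s2 x = s1 x"
      show "wp (Seq rev_loop
        (Seq (Assign vRAT (ETl (EVar vROW))) (Seq neg_rat_com
        (Assign vROW (ECons (EVar vTMP) (EVar vRAT)))))) s2
        (\<lambda>u s'. s' vROW = enc_row (neg_row r) \<and> t1 + (t2 + u) \<le> 100 * n + 60)"
      proof (rule wp_SeqI[OF wp_rev_loop[of s2 "rev (map uminus ?qs)" "[]"]])
        fix t3 :: nat and s3 :: store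
        assume s3: "s3 vTMP = enc_list enc_rat (rev (rev (map uminus ?qs)) @ []) \<and>
            t3 \<le> 50 * length (rev (map uminus ?qs)) + 2"
          and f3: "\<forall>x. x \<notin> modified rev_loop \<longrightarrow> s3 x = s2 x"
        have 1: "s3 vROW = Node (enc_list enc_rat ?qs) (enc_rat (snd r))"
          using f2 f3 neg rev s1 row by simp
        have 2: "s3 vTMP = enc_vec (- fst r)" using s3 by (simp add: enc_vec_uminus)
        have 3: "t1 + (t2 + t3) \<le> 100 * n + 9" using s1 s2 s3 len by simp
        show "wp (Seq (Assign vRAT (ETl (EVar vROW))) (Seq neg_rat_com
            (Assign vROW (ECons (EVar vTMP) (EVar vRAT))))) s3
            (\<lambda>u s'. s' vROW = enc_row (neg_row r) \<and> t1 + (t2 + (t3 + u)) \<le> 100 * n + 60)"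
          unfolding wp_Seq wp_Assign
          by (rule wp_neg_rat[of _ "snd r"]) (use 1 2 3 in \<open>simp_all add: neg_row_def enc_row_simp\<close>)
      qed (use s2 in simp_all)
    qed (use s1 in simp_all)
  qed
qed

section \<open>Comparing trees\<close>

text \<open>The stack holds the pairs still to be compared. A mismatch clears \<open>vOK\<close> and
  empties the stack, which ends the loop; success leaves \<open>vOK\<close> as it was, so
  consecutive comparisons accumulate a conjunction.\<close>

definition cmp_body :: com where
  "cmp_body =
    Seq (Assign vTMP (EHd (EVar vSTACK))) (Seq (Assign vSTACK (ETl (EVar vSTACK)))
    (Cond (EHd (EVar vTMP))
      (Cond (ETl (EVar vTMP))
        (Assign vSTACK
          (ECons (ECons (EHd (EHd (EVar vTMP))) (EHd (ETl (EVar vTMP))))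
          (ECons (ECons (ETl (EHd (EVar vTMP))) (ETl (ETl (EVar vTMP)))) (EVar vSTACK))))
        (Seq (Assign vOK ENil) (Assign vSTACK ENil)))
      (Cond (ETl (EVar vTMP))
        (Seq (Assign vOK ENil) (Assign vSTACK ENil))
        (Assign vTMP ENil))))"

abbreviation "cmp_loop \<equiv> While (EVar vSTACK) cmp_body"

text \<open>The total \<open>common_size\<close> on the stack drops by one whenever a pair of nodes
  is replaced by its two pairs of children or a pair of leaves is removed; a mismatch ends the
  loop.\<close>

lemma wp_cmp_loop:
  assumes "s vSTACK = enc_list (enc_pair id id) ps"
  shows "wp cmp_loop s (\<lambda>t s'.
    s' vOK = (if \<forall>(x, y) \<in> set ps. x = y then s vOK else Leaf) \<and>
    t \<le> 50 * (\<Sum>(x, y) \<leftarrow> ps. common_size x y) + 2)"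
  using assms
proof (induction "\<Sum>(x, y) \<leftarrow> ps. common_size x y" arbitrary: ps s rule: less_induct)
  case less
  let ?m = "\<lambda>ps. \<Sum>(x, y) \<leftarrow> ps. common_size x y"
  show ?case
  proof (cases ps)
    case Nil
    then show ?thesis using less.prems by (simp add: wp_While_Leaf)
  next
    case (Cons p qs)
    obtain x y where p: "p = (x, y)" by fastforce
    have st: "s vSTACK = Node (Node x y) (enc_list (enc_pair id id) qs)"
      using less.prems by (simp add: Cons p)
    have ne: "eval_exp (EVar vSTACK) s \<noteq> Leaf" using st by simp
    consider (NN) a b c d where "x = Node a b" "y = Node c d"
      | (NL) a b where "x = Node a b" "y = Leaf"
      | (LN) c d where "x = Leaf" "y = Node c d"
      | (LL) "x = Leaf" "y = Leaf"
      by (cases x; cases y) auto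
    then show ?thesis
    proof cases
      case NN
      let ?ps = "(a, c) # (b, d) # qs"
      have less': "?m ?ps < ?m ps" by (simp add: Cons p NN)
      have "wp cmp_body s (\<lambda>t s'. s' vSTACK = enc_list (enc_pair id id) ?ps \<and> s' vOK = s vOK \<and> t \<le> 45)"
        by (simp add: cmp_body_def st NN)
      with ne show ?thesis
      proof (rule wp_WhileI)
        fix t :: nat and s' :: store
        assume s': "s' vSTACK = enc_list (enc_pair id id) ?ps \<and> s' vOK = s vOK \<and> t \<le> 45"
        show "wp cmp_loop s' (\<lambda>u s''. s'' vOK = (if \<forall>(x, y) \<in> set ps. x = y then s vOK else Leaf) \<and>
            1 + exp_time (EVar vSTACK) + t + u \<le> 50 * ?m ps + 2)"
          by (rule wp_frame[OF less.hyps[OF less']])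
            (use s' in \<open>simp_all add: Cons p NN split: if_splits\<close>)
      qed
    next
      case NL
      have "wp cmp_body s (\<lambda>t s'. s' vSTACK = Leaf \<and> s' vOK = Leaf \<and> t \<le> 45)"
        by (simp add: cmp_body_def st NL)
      with ne show ?thesis
        by (rule wp_WhileI) (simp add: wp_While_Leaf Cons p NL)
    next
      case LN
      have "wp cmp_body s (\<lambda>t s'. s' vSTACK = Leaf \<and> s' vOK = Leaf \<and> t \<le> 45)"
        by (simp add: cmp_body_def st LN)
      with ne show ?thesis
        by (rule wp_WhileI) (simp add: wp_While_Leaf Cons p LN)
    next
      case LL
      have less': "?m qs < ?m ps" by (simp add: Cons p LL)
      have "wp cmp_body s (\<lambda>t s'. s' vSTACK = enc_list (enc_pair id id) qs \<and> s' vOK = s vOK \<and> t \<le> 45)"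
        by (simp add: cmp_body_def st LL)
      with ne show ?thesis
      proof (rule wp_WhileI)
        fix t :: nat and s' :: store
        assume s': "s' vSTACK = enc_list (enc_pair id id) qs \<and> s' vOK = s vOK \<and> t \<le> 45"
        show "wp cmp_loop s' (\<lambda>u s''. s'' vOK = (if \<forall>(x, y) \<in> set ps. x = y then s vOK else Leaf) \<and>
            1 + exp_time (EVar vSTACK) + t + u \<le> 50 * ?m ps + 2)"
          by (rule wp_frame[OF less.hyps[OF less']])
            (use s' in \<open>simp_all add: Cons p LL split: if_splits\<close>)
      qed
    qed
  qed
qed

section \<open>Calling the solver and testing its answer\<close>

definition lp_call :: com where
  "lp_call = Seq (clear_vars N) (Seq (Assign 0 (ECons (EHd (EVar vROW)) (EVar vRS))) lp)"

text \<open>After clearing, the store agrees on the variables up to \<open>N\<close> with the one in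
  the solver's specification, so \<open>exec_relocate\<close> transfers the run and preserves
  everything above \<open>N\<close>.\<close>

lemma wp_lp_call:
  assumes "s vROW = enc_row r" and "s vRS = enc_list enc_row rs"
    and "row_ok n L r" and "\<forall>q \<in> set rs. row_ok n L q" and "length rs \<le> b"
  shows "wp lp_call s (\<lambda>t s'. \<exists>res. lp_answer n (fst r) rs res \<and> s' 0 = enc_lp_result res \<and>
    (\<forall>x. N < x \<longrightarrow> s' x = s x) \<and> t \<le> LP n b L + 2 * N + 10)"
proof -
  have "vec_ok n L (fst r)" using assms(3) by (simp add: row_ok_def)
  then obtain res t where res: "lp_answer n (fst r) rs res" "t \<le> LP n b L"
    "computes lp (enc_lp (fst r, rs)) (enc_lp_result res) t"
    using lp assms(4,5) unfolding solves_linear_programming_def by blast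
  then obtain s' where s': "exec lp ((\<lambda>_. Leaf)(0 := enc_lp (fst r, rs))) t s'"
      "s' 0 = enc_lp_result res"
    unfolding computes_def by (elim exE conjE)
  let ?s = "(\<lambda>x. if x \<le> N then Leaf else s x)(0 := enc_lp (fst r, rs))"
  have "exec lp ?s t (\<lambda>x. if x \<in> {..N} then s' x else ?s x)"
    by (rule exec_relocate[OF s'(1) lp_vars]) simp
  then have "wp lp ?s (\<lambda>t' s''. t' = t \<and> s'' = (\<lambda>x. if x \<in> {..N} then s' x else ?s x))"
    unfolding wp_def by (intro exI conjI) auto
  then show ?thesis
    unfolding lp_call_def wp_Seq wp_Assign wp_clear_vars
    using assms(1,2) apply (simp add: enc_row_simp enc_lp_def)
    apply (erule wp_frame)
    apply (intro exI[of _ res])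
    using res(1,2) s'(2) by simp
qed

lemma modified_lp_call: "x \<in> modified lp_call \<Longrightarrow> x \<le> N"
  using modified_subset_com_vars[of lp] modified_clear_vars[of N] lp_vars
  by (auto simp: lp_call_def)

text \<open>The tree built from \<open>vROW\<close> is the encoding of \<open>Optimum b\<close>.
  \<open>Infeasible\<close> is \<open>Leaf\<close> and skips the comparison, while
  \<open>Unbounded\<close> fails it already at the tag.\<close>

definition test_row_com :: com where
  "test_row_com = Seq lp_call (Cond (EVar 0)
    (Seq (Assign vSTACK (ECons (ECons (EVar 0) (ECons ETrue (ETl (EVar vROW)))) ENil)) cmp_loop)
    (Assign vTMP ENil))"

lemma modified_test_row_com: "x \<in> modified test_row_com \<Longrightarrow> x \<le> N \<or> x \<in> {vSTACK, vTMP, vOK}"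
  using modified_lp_call by (auto simp: test_row_com_def cmp_body_def)

text \<open>The accounting unit: one solver call with its overhead. The factor depends only on the
  number of variables reserved for the solver.\<close>

definition quantum :: "nat \<Rightarrow> nat \<Rightarrow> nat \<Rightarrow> nat" where
  "quantum n b L = (2 * N + 3000) * LP n b L"

text \<open>In dimension 0 the solver need not read the numbers, but then the only optimum is 0, whose encoding
  has constant size.\<close>

lemma common_size_result:
  assumes "lp_answer n f rs res" and "res \<noteq> Infeasible" and "rat_bits b \<le> L" and "3 \<le> L" and "1 \<le> k"
  shows "common_size (enc_lp_result res) (Node (enc_bool True) (enc_rat b)) \<le> 4 * LP n k L + 30"
proof (cases "n = 0")
  case True
  have "lin f x = 0" if "x \<in> feasible_set n rs" for x
    using that True feasible_set_carrier[OF that] by (simp add: lin_def scalar_prod_def)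
  then have "res \<noteq> Unbounded"
    using assms(1) by (auto intro!: bdd_aboveI[of _ 0])
  then obtain v where v: "res = Optimum v" using assms(2) by (cases res) auto
  then have "v = 0"
    using assms(1) \<open>\<And>x. x \<in> feasible_set n rs \<Longrightarrow> lin f x = 0\<close> by auto
  then have "tree_size (enc_lp_result res) \<le> 19"
    using v tree_size_enc_rat[of 0] by simp
  then show ?thesis
    using common_size_le(1)[of "enc_lp_result res" "Node (enc_bool True) (enc_rat b)"] by linarith
next
  case False
  then have "L \<le> LP n k L + 3" using lp_time_ge_bits[OF lp _ assms(5)] by simp
  \<comment> \<open>The bound comes from the expected value, which has at most \<open>L\<close>
    bits; the optimum may have more.\<close>
  moreover have "tree_size (Node (enc_bool True) (enc_rat b)) \<le> 4 * L + 11"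
    using tree_size_enc_rat[of b] assms(3) by simp
  ultimately show ?thesis
    using common_size_le(2)[where x = "enc_lp_result res" and y = "Node (enc_bool True) (enc_rat b)"] by linarith
qed

lemma wp_test_row:
  assumes "s vROW = enc_row r" and "s vRS = enc_list enc_row rs"
    and "row_ok n L r" and "\<forall>q \<in> set rs. row_ok n L q" and "length rs \<le> k" and "3 \<le> L" "1 \<le> k"
  shows "wp test_row_com s (\<lambda>t s'. s' vOK = (if max_is n rs r then s vOK else Leaf) \<and>
    t \<le> quantum n k L)"
proof -
  have LP: "1 \<le> LP n k L" using lp_time_pos[OF lp] assms(6) by (simp add: Suc_le_eq)
  then have "2 * N * 1 \<le> 2 * N * LP n k L" by (rule mult_le_mono2)
  \<comment> \<open>The term \<open>250 * LP n k L + 1700\<close> leaves room for the comparison,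
    which takes at most \<open>50 * (4 * LP n k L + 30) + 2\<close> steps, and for the surrounding
    commands.\<close>
  then have T: "LP n k L + 2 * N + 10 + 250 * LP n k L + 1700 \<le> quantum n k L"
    using LP by (simp add: quantum_def algebra_simps)
  show ?thesis
    unfolding test_row_com_def
  proof (rule wp_SeqI[OF wp_lp_call[OF assms(1-5)]])
    fix t :: nat and s' :: store
    assume "\<exists>res. lp_answer n (fst r) rs res \<and> s' 0 = enc_lp_result res \<and>
      (\<forall>x. N < x \<longrightarrow> s' x = s x) \<and> t \<le> LP n k L + 2 * N + 10"
    then obtain res where res: "lp_answer n (fst r) rs res" "s' 0 = enc_lp_result res"
      and frame: "\<forall>x. N < x \<longrightarrow> s' x = s x" and t: "t \<le> LP n k L + 2 * N + 10"
      by blast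
    let ?goal = "\<lambda>u s''. s'' vOK = (if max_is n rs r then s vOK else Leaf) \<and> t + u \<le> quantum n k L"
    let ?x = "enc_lp_result res" and ?y = "Node (enc_bool True) (enc_rat (snd r))"
    have ROW: "s' vROW = enc_row r" using frame assms(1) by simp
    show "wp (Cond (EVar 0) (Seq (Assign vSTACK
          (ECons (ECons (EVar 0) (ECons ETrue (ETl (EVar vROW)))) ENil)) cmp_loop) (Assign vTMP ENil)) s' ?goal"
    proof (cases "res = Infeasible")
      case True
      then have "max_is n rs r" using res(1) by (simp add: max_is_def)
      then show ?thesis using True res(2) t T frame by simp
    next
      case False
      have ne: "?x \<noteq> Leaf" using False by (cases res) auto
      have eq: "?x = ?y \<longleftrightarrow> max_is n rs r"
      proof
        assume "?x = ?y"
        then have "res = Optimum (snd r)" by (cases res) auto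
        then show "max_is n rs r" using res(1) by (simp add: max_is_def)
      next
        assume "max_is n rs r"
        moreover have "feasible_set n rs \<noteq> {}" using res(1) False by (cases res) auto
        ultimately have opt: "lp_answer n (fst r) rs (Optimum (snd r))" by (simp add: max_is_def)
        have "res = Optimum (snd r)" by (rule lp_answer_Optimum_unique[OF opt res(1)])
        then show "?x = ?y" by simp
      qed
      have size: "common_size ?x ?y \<le> 4 * LP n k L + 30"
        by (rule common_size_result[OF res(1) False _ assms(6,7)]) (use assms(3) in \<open>simp add: row_ok_def\<close>)
      let ?s = "s'(vSTACK := enc_list (enc_pair id id) [(?x, ?y)])"
      have "wp cmp_loop ?s (\<lambda>u s''. s'' vOK = (if \<forall>(x, y) \<in> set [(?x, ?y)]. x = y then ?s vOK else Leaf) \<and>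
          u \<le> 50 * (\<Sum>(x, y) \<leftarrow> [(?x, ?y)]. common_size x y) + 2)"
        by (rule wp_cmp_loop) simp
      then have cmp: "wp cmp_loop ?s (\<lambda>u s''. s'' vOK = (if max_is n rs r then s vOK else Leaf) \<and>
          u \<le> 50 * (4 * LP n k L + 30) + 2)"
        by (rule wp_frame) (use size frame eq in auto)
      show ?thesis
        using cmp ne res(2) ROW
        by (simp add: enc_row_simp split del: if_split) (erule wp_frame, use t T in simp)
    qed
  qed
qed

section \<open>The elimination loops\<close>

definition eqs_body :: com where
  "eqs_body = Seq (Assign vROW (EHd (EVar vEQS))) (Seq test_row_com (Seq neg_row_com
    (Seq test_row_com (Assign vEQS (ETl (EVar vEQS))))))"

abbreviation "eqs_loop \<equiv> While (EVar vEQS) eqs_body"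

definition block_body :: com where
  "block_body =
    Seq (Seq (Assign vOK ETrue) (Assign vEQS (EHd (EHd (EVar vTODO)))))
    (Seq eqs_loop
    (Cond (EVar vOK)
      (Seq (Assign vROW (ETl (EHd (EVar vTODO)))) (Seq neg_row_com
      (Seq (Assign vRS (ECons (EVar vROW) (EVar vRS)))
      (Seq (Assign vNEW ETrue) (Assign vTODO (ETl (EVar vTODO)))))))
      (Seq (Assign vREST (ECons (EHd (EVar vTODO)) (EVar vREST))) (Assign vTODO (ETl (EVar vTODO))))))"

abbreviation "scan_loop \<equiv> While (EVar vTODO) block_body"

text \<open>A set that could not be treated may become treatable after later constraints, so the
  sets set aside are rescanned until a whole round adds nothing.\<close>

definition round_body :: com where
  "round_body = Seq (Seq (Assign vNEW ENil) (Seq (Assign vTODO (EVar vREST)) (Assign vREST ENil))) scan_loop"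

abbreviation "round_loop \<equiv> While (EVar vNEW) round_body"

text \<open>The last call only asks for feasibility, so any objective of the right dimension will
  do; the inequality of the first set is saved in \<open>vOBJ\<close> for this. \<open>vNEW\<close>
  starts true to force the first round.\<close>

definition elim_com :: com where
  "elim_com =
    Seq (Seq (Assign vREST (EVar 0)) (Seq (Assign vOBJ (ETl (EHd (EVar 0))))
      (Seq (Assign vRS ENil) (Assign vNEW ETrue))))
    (Seq round_loop
    (Seq (Assign vROW (EVar vOBJ))
    (Seq lp_call
    (Cond (EVar 0) (Assign 0 ENil) (Assign 0 ETrue)))))"

lemma modified_eqs_body: "x \<in> modified eqs_body \<Longrightarrow> x \<le> N \<or>
    x \<in> {vSTACK, vTMP, vOK, vREV, vRAT, vROW, vEQS}"
  using modified_test_row_com by (auto simp: eqs_body_def)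

lemma modified_round_body: "x \<in> modified round_body \<Longrightarrow> x \<noteq> vOBJ"
  using modified_eqs_body[of vOBJ] by (auto simp: round_body_def block_body_def)

end

locale elimination_run = lp_solver +
  fixes n L :: nat and Bs :: "block list"
  assumes inst: "elim_instance n L Bs"
begin

abbreviation "K \<equiv> max_eqs Bs"
abbreviation "k \<equiv> length Bs * max_eqs Bs"
abbreviation "X \<equiv> quantum n k L"

lemma L_ge_3: "3 \<le> L"
  by (rule elim_instance_bits_ge_3[OF inst])

lemma K_ge_1: "1 \<le> K"
  by (simp add: max_eqs_def)

lemma length_eqs_le: "(eqs, r) \<in> set Bs \<Longrightarrow> length eqs \<le> K"
  unfolding max_eqs_def by (rule Max_ge) force+

lemma length_Bs_ge_1: "1 \<le> length Bs"
  using inst by (cases Bs) (auto simp: elim_instance_def)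

text \<open>Each set yields at most one constraint, so this brings every linear program under the
  constraint bound \<open>m * K\<close> of the claim.\<close>

lemma length_Bs_le_k: "length Bs \<le> k"
  using mult_le_mono2[OF K_ge_1, of "length Bs"] by simp

lemma k_ge_1: "1 \<le> k"
  using length_Bs_ge_1 length_Bs_le_k by linarith

text \<open>The lower bound on the solver's time by the dimension is what lets the
  \<open>O(n)\<close> cost of negating a row be charged to a call.\<close>

lemma quantum_ge: "LP n k L + 2 * N + 10 \<le> X" "100 * n + 500 \<le> X"
proof -
  have LP: "1 \<le> LP n k L" using lp_time_pos[OF lp] L_ge_3 by (simp add: Suc_le_eq)
  then have "2 * N * 1 \<le> 2 * N * LP n k L" by (rule mult_le_mono2)
  moreover have "n \<le> LP n k L" by (rule lp_time_ge_dimension[OF lp L_ge_3 k_ge_1])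
  moreover have "X = 2 * N * LP n k L + 3000 * LP n k L"
    by (simp add: quantum_def add_mult_distrib)
  ultimately show "LP n k L + 2 * N + 10 \<le> X" "100 * n + 500 \<le> X"
    using LP by linarith+
qed

lemma X_le_KX: "X \<le> K * X"
  using mult_le_mono1[OF K_ge_1, of X] by simp

lemma elim_inv_rows:
  assumes "elim_inv n L Bs rs pend"
  shows "\<forall>r \<in> set rs. row_ok n L r" and "length rs \<le> k"
proof -
  show "\<forall>r \<in> set rs. row_ok n L r" using assms by (simp add: elim_inv_def)
  have "length rs \<le> length Bs" using assms by (simp add: elim_inv_def)
  then show "length rs \<le> k" using length_Bs_le_k by (rule le_trans)
qed

text \<open>Two tests and one negation per equation, where the negation and the loop overhead fit
  into a third quantum.\<close>

lemma wp_eqs_loop: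
  assumes "s vEQS = enc_list enc_row eqs" and "s vRS = enc_list enc_row rs"
    and "\<forall>r \<in> set eqs. row_ok n L r" and rs: "\<forall>r \<in> set rs. row_ok n L r" "length rs \<le> k"
  shows "wp eqs_loop s (\<lambda>t s'. s' vOK = (if contained n rs eqs then s vOK else Leaf) \<and>
    t \<le> length eqs * (3 * X) + 2)"
  using assms(1-3)
proof (induction eqs arbitrary: s)
  case Nil
  then show ?case by (simp add: wp_While_Leaf)
next
  case (Cons r eqs)
  have ne: "eval_exp (EVar vEQS) s \<noteq> Leaf" using Cons.prems by simp
  have "row_ok n L r" using Cons.prems(3) by simp
  then have r: "row_ok n L r" "row_ok n L (neg_row r)" "fst r \<in> carrier_vec n"
    by (simp_all add: row_ok_neg_row) (simp add: row_ok_def vec_ok_def)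
  have nm: "x \<notin> modified test_row_com" if "x \<in> {vROW, vRS, vEQS}" for x
    using that modified_test_row_com[of x] by auto
  have "wp eqs_body s (\<lambda>t s'.
      s' vOK = (if max_is n rs r \<and> max_is n rs (neg_row r) then s vOK else Leaf) \<and>
      s' vEQS = enc_list enc_row eqs \<and> t \<le> 2 * X + 100 * n + 80)"
    unfolding eqs_body_def
  proof (rule wp_SeqI)
    show "wp (Assign vROW (EHd (EVar vEQS))) s (\<lambda>t s'. s' = s(vROW := enc_row r) \<and> t = 3)"
      using Cons.prems(1) by simp
  next
    fix t1 :: nat and s1 :: store
    assume s1: "s1 = s(vROW := enc_row r) \<and> t1 = 3"
    show "wp (Seq test_row_com (Seq neg_row_com
        (Seq test_row_com (Assign vEQS (ETl (EVar vEQS)))))) s1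
      (\<lambda>u s'. s' vOK = (if max_is n rs r \<and> max_is n rs (neg_row r) then s vOK else Leaf) \<and>
        s' vEQS = enc_list enc_row eqs \<and> t1 + u \<le> 2 * X + 100 * n + 80)"
    proof (rule wp_SeqI[OF wp_test_row[OF _ _ r(1) rs L_ge_3 k_ge_1]])
      show "s1 vROW = enc_row r" "s1 vRS = enc_list enc_row rs"
        using s1 Cons.prems(2) by simp_all
      fix t2 :: nat and s2 :: store
      assume s2: "s2 vOK = (if max_is n rs r then s1 vOK else Leaf) \<and> t2 \<le> X"
        and f2: "\<forall>x. x \<notin> modified test_row_com \<longrightarrow> s2 x = s1 x"
      show "wp (Seq neg_row_com (Seq test_row_com (Assign vEQS (ETl (EVar vEQS))))) s2
        (\<lambda>u s'. s' vOK = (if max_is n rs r \<and> max_is n rs (neg_row r) then s vOK else Leaf) \<and>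
          s' vEQS = enc_list enc_row eqs \<and> t1 + (t2 + u) \<le> 2 * X + 100 * n + 80)"
      proof (rule wp_SeqI[OF wp_neg_row[OF _ r(3)]])
        show "s2 vROW = enc_row r" using f2 nm s1 by simp
        fix t3 :: nat and s3 :: store
        assume s3: "s3 vROW = enc_row (neg_row r) \<and> t3 \<le> 100 * n + 60"
          and f3: "\<forall>x. x \<notin> modified neg_row_com \<longrightarrow> s3 x = s2 x"
        have s3': "s3 vRS = enc_list enc_row rs" "s3 vEQS = s vEQS" "s3 vOK = s2 vOK"
          using f3 f2 nm s1 Cons.prems(2) by simp_all
        show "wp (Seq test_row_com (Assign vEQS (ETl (EVar vEQS)))) s3
          (\<lambda>u s'. s' vOK = (if max_is n rs r \<and> max_is n rs (neg_row r) then s vOK else Leaf) \<and>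
            s' vEQS = enc_list enc_row eqs \<and> t1 + (t2 + (t3 + u)) \<le> 2 * X + 100 * n + 80)"
        proof (rule wp_SeqI[OF wp_test_row[OF _ _ r(2) rs L_ge_3 k_ge_1]])
          fix t4 :: nat and s4 :: store
          assume s4: "s4 vOK = (if max_is n rs (neg_row r) then s3 vOK else Leaf) \<and> t4 \<le> X"
            and f4: "\<forall>x. x \<notin> modified test_row_com \<longrightarrow> s4 x = s3 x"
          have "s4 vEQS = s vEQS" using f4 nm s3'(2) by simp
          then show "wp (Assign vEQS (ETl (EVar vEQS))) s4
            (\<lambda>u s'. s' vOK = (if max_is n rs r \<and> max_is n rs (neg_row r) then s vOK else Leaf) \<and>
              s' vEQS = enc_list enc_row eqs \<and> t1 + (t2 + (t3 + (t4 + u))) \<le> 2 * X + 100 * n + 80)"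
            using s1 s2 s3 s3' s4 Cons.prems(1) by simp
        qed (use s3 s3' in simp_all)
      qed
    qed
  qed
  with ne show ?case
  proof (rule wp_WhileI)
    fix t :: nat and s' :: store
    assume s': "s' vOK = (if max_is n rs r \<and> max_is n rs (neg_row r) then s vOK else Leaf) \<and>
        s' vEQS = enc_list enc_row eqs \<and> t \<le> 2 * X + 100 * n + 80"
      and f: "\<forall>x. x \<notin> modified eqs_body \<longrightarrow> s' x = s x"
    have "vRS \<notin> modified eqs_body" using modified_eqs_body[of vRS] by auto
    then have RS: "s' vRS = enc_list enc_row rs" using f Cons.prems(2) by simp
    show "wp eqs_loop s' (\<lambda>u s''. s'' vOK = (if contained n rs (r # eqs) then s vOK else Leaf) \<and>
        1 + exp_time (EVar vEQS) + t + u \<le> length (r # eqs) * (3 * X) + 2)"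
      by (rule wp_frame[OF Cons.IH[of s']])
        (use s' RS Cons.prems(3) quantum_ge(2) contained_Cons[OF r(3)] in auto)
  qed
qed

text \<open>The equations cost \<open>3 * X\<close> each; the work outside their loop is charged to
  the remaining \<open>2 * (K * X)\<close>, which is positive even for a set without equations
  because \<open>K \<ge> 1\<close>.\<close>

lemma wp_block_body:
  assumes "s vTODO = enc_blocks ((eqs, r) # todo)" and "s vRS = enc_list enc_row rs"
    and B: "(eqs, r) \<in> set Bs" and rs: "\<forall>r \<in> set rs. row_ok n L r" "length rs \<le> k"
  shows "wp block_body s (\<lambda>t s'. s' vTODO = enc_blocks todo \<and>
    (if contained n rs eqs
     then s' vRS = enc_list enc_row (neg_row r # rs) \<and> s' vREST = s vREST \<and> s' vNEW = enc_bool True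
     else s' vRS = s vRS \<and> s' vREST = Node (enc_pair (enc_list enc_row) enc_row (eqs, r)) (s vREST) \<and>
       s' vNEW = s vNEW) \<and>
    t \<le> K * (5 * X))"
proof -
  note ok = elim_instanceD[OF inst B]
  have r: "fst r \<in> carrier_vec n" using ok(2) by (simp add: row_ok_def vec_ok_def)
  have "length eqs * (3 * X) \<le> K * (3 * X)"
    using length_eqs_le[OF B] by (rule mult_le_mono1)
  moreover have "K * (3 * X) = 3 * (K * X)" "K * (5 * X) = 5 * (K * X)" by simp_all
  ultimately have time: "length eqs * (3 * X) + 100 * n + 500 \<le> K * (5 * X)"
    using X_le_KX quantum_ge(2) by linarith
  have todo: "s vTODO = Node (Node (enc_list enc_row eqs) (enc_row r)) (enc_blocks todo)"
    using assms(1) by (simp add: enc_blocks_def)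
  show ?thesis
    unfolding block_body_def
  proof (rule wp_SeqI)
    show "wp (Seq (Assign vOK ETrue) (Assign vEQS (EHd (EHd (EVar vTODO))))) s
      (\<lambda>t s'. s' = s(vOK := Node Leaf Leaf, vEQS := enc_list enc_row eqs) \<and> t = 8)"
      using todo by simp
  next
    fix t1 :: nat and s1 :: store
    assume s1: "s1 = s(vOK := Node Leaf Leaf, vEQS := enc_list enc_row eqs) \<and> t1 = 8"
    show "wp (Seq eqs_loop (Cond (EVar vOK)
      (Seq (Assign vROW (ETl (EHd (EVar vTODO)))) (Seq neg_row_com
      (Seq (Assign vRS (ECons (EVar vROW) (EVar vRS)))
      (Seq (Assign vNEW ETrue) (Assign vTODO (ETl (EVar vTODO)))))))
      (Seq (Assign vREST (ECons (EHd (EVar vTODO)) (EVar vREST))) (Assign vTODO (ETl (EVar vTODO)))))) s1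
      (\<lambda>u s'. s' vTODO = enc_blocks todo \<and>
        (if contained n rs eqs
         then s' vRS = enc_list enc_row (neg_row r # rs) \<and> s' vREST = s vREST \<and> s' vNEW = enc_bool True
         else s' vRS = s vRS \<and> s' vREST = Node (enc_pair (enc_list enc_row) enc_row (eqs, r)) (s vREST) \<and>
           s' vNEW = s vNEW) \<and> t1 + u \<le> K * (5 * X))"
    proof (rule wp_SeqI[OF wp_eqs_loop[OF _ _ ok(1) rs]])
      fix t2 :: nat and s2 :: store
      assume s2: "s2 vOK = (if contained n rs eqs then s1 vOK else Leaf) \<and>
          t2 \<le> length eqs * (3 * X) + 2"
        and f2: "\<forall>x. x \<notin> modified eqs_loop \<longrightarrow> s2 x = s1 x"
      have f: "s2 x = s x" if x: "x \<in> {vRS, vREST, vNEW, vTODO}" for x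
      proof -
        have "x \<notin> modified eqs_loop" using x modified_eqs_body[of x] by auto
        then show ?thesis using f2 s1 x by auto
      qed
      show "wp (Cond (EVar vOK)
        (Seq (Assign vROW (ETl (EHd (EVar vTODO)))) (Seq neg_row_com
        (Seq (Assign vRS (ECons (EVar vROW) (EVar vRS)))
        (Seq (Assign vNEW ETrue) (Assign vTODO (ETl (EVar vTODO)))))))
        (Seq (Assign vREST (ECons (EHd (EVar vTODO)) (EVar vREST))) (Assign vTODO (ETl (EVar vTODO))))) s2
        (\<lambda>u s'. s' vTODO = enc_blocks todo \<and>
          (if contained n rs eqs
           then s' vRS = enc_list enc_row (neg_row r # rs) \<and> s' vREST = s vREST \<and> s' vNEW = enc_bool True
           else s' vRS = s vRS \<and> s' vREST = Node (enc_pair (enc_list enc_row) enc_row (eqs, r)) (s vREST) \<and>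
             s' vNEW = s vNEW) \<and> t1 + (t2 + u) \<le> K * (5 * X))"
      proof (cases "contained n rs eqs")
        case False
        then show ?thesis using s2 f todo s1 time by simp
      next
        case True
        have neg: "wp neg_row_com (s2(vROW := enc_row r))
            (\<lambda>t s'. s' vROW = enc_row (neg_row r) \<and> t \<le> 100 * n + 60)"
          by (rule wp_neg_row[OF _ r]) simp
        show ?thesis
          using s2 f todo s1 True
          by (simp, intro wp_frame[OF neg]) (use assms(2) time in simp)
      qed
    qed (use s1 assms(2) in simp_all)
  qed
qed

text \<open>While \<open>new\<close> is false, the constraints have not changed since the sets in
  \<open>rest\<close> were rejected, so those rejections are still valid. Once a constraint is added
  nothing is claimed about them, but the number of pending sets has dropped, which bounds the number
  of rounds.\<close>

lemma wp_scan_loop: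
  assumes "s vTODO = enc_blocks todo" and "s vREST = enc_blocks rest"
    and "s vRS = enc_list enc_row rs" and "s vNEW = enc_bool new"
    and "elim_inv n L Bs rs (todo @ rest)"
    and "\<not> new \<longrightarrow> (\<forall>B \<in> set rest. \<not> contained n rs (fst B))"
  shows "wp scan_loop s (\<lambda>t s'. \<exists>rest' rs' new'. s' vREST = enc_blocks rest' \<and>
    s' vRS = enc_list enc_row rs' \<and> s' vNEW = enc_bool new' \<and> elim_inv n L Bs rs' rest' \<and>
    (\<not> new' \<longrightarrow> (\<forall>B \<in> set rest'. \<not> contained n rs' (fst B))) \<and>
    length rest' \<le> length todo + length rest \<and>
    (new' \<longrightarrow> new \<or> length rest' < length todo + length rest) \<and>
    t \<le> length todo * (K * (6 * X)) + 2)"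
  using assms
proof (induction todo arbitrary: s rest rs new)
  case Nil
  then show ?case by (simp add: wp_While_Leaf enc_blocks_def) blast
next
  case (Cons B todo)
  obtain eqs r where B: "B = (eqs, r)" by (cases B)
  have ne: "eval_exp (EVar vTODO) s \<noteq> Leaf" using Cons.prems(1) by (simp add: enc_blocks_def)
  have inv: "elim_inv n L Bs rs (((eqs, r) # todo) @ rest)" using Cons.prems(5) B by simp
  have mem: "(eqs, r) \<in> set Bs" using inv by (simp add: elim_inv_def)
  note rs = elim_inv_rows[OF inv]
  have "K * (5 * X) = 5 * (K * X)" "K * (6 * X) = 6 * (K * X)" by simp_all
  then have KX: "K * (5 * X) + 2 \<le> K * (6 * X)"
    using X_le_KX quantum_ge(2) by linarith
  from ne wp_block_body[OF Cons.prems(1)[unfolded B] Cons.prems(3) mem rs]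
  show ?case
  proof (rule wp_WhileI)
    fix t :: nat and s' :: store
    assume s': "s' vTODO = enc_blocks todo \<and>
      (if contained n rs eqs
       then s' vRS = enc_list enc_row (neg_row r # rs) \<and> s' vREST = s vREST \<and> s' vNEW = enc_bool True
       else s' vRS = s vRS \<and> s' vREST = Node (enc_pair (enc_list enc_row) enc_row (eqs, r)) (s vREST) \<and>
         s' vNEW = s vNEW) \<and>
      t \<le> K * (5 * X)"
    let ?goal = "\<lambda>u s''. \<exists>rest' rs' new'. s'' vREST = enc_blocks rest' \<and>
      s'' vRS = enc_list enc_row rs' \<and> s'' vNEW = enc_bool new' \<and> elim_inv n L Bs rs' rest' \<and>
      (\<not> new' \<longrightarrow> (\<forall>B \<in> set rest'. \<not> contained n rs' (fst B))) \<and>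
      length rest' \<le> length (B # todo) + length rest \<and>
      (new' \<longrightarrow> new \<or> length rest' < length (B # todo) + length rest) \<and>
      1 + exp_time (EVar vTODO) + t + u \<le> length (B # todo) * (K * (6 * X)) + 2"
    show "wp scan_loop s' ?goal"
    proof (cases "contained n rs eqs")
      case True
      have "elim_inv n L Bs (neg_row r # rs) (todo @ rest)"
        by (rule elim_inv_add[OF inst inv True])
      \<comment> \<open>The induction hypothesis is used with the flag already true; the strict
        decrease comes from the removal of \<open>B\<close>.\<close>
      then have "wp scan_loop s' (\<lambda>t s'. \<exists>rest' rs' new'. s' vREST = enc_blocks rest' \<and>
        s' vRS = enc_list enc_row rs' \<and> s' vNEW = enc_bool new' \<and> elim_inv n L Bs rs' rest' \<and>
        (\<not> new' \<longrightarrow> (\<forall>B \<in> set rest'. \<not> contained n rs' (fst B))) \<and>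
        length rest' \<le> length todo + length rest \<and>
        (new' \<longrightarrow> True \<or> length rest' < length todo + length rest) \<and>
        t \<le> length todo * (K * (6 * X)) + 2)"
        using s' True Cons.prems(2) by (intro Cons.IH) simp_all
      then show ?thesis
        by (rule wp_frame) (elim exE conjE, intro exI conjI, assumption+, use s' KX in auto)
    next
      case False
      have "wp scan_loop s' (\<lambda>t s'. \<exists>rest' rs' new'. s' vREST = enc_blocks rest' \<and>
        s' vRS = enc_list enc_row rs' \<and> s' vNEW = enc_bool new' \<and> elim_inv n L Bs rs' rest' \<and>
        (\<not> new' \<longrightarrow> (\<forall>B \<in> set rest'. \<not> contained n rs' (fst B))) \<and>
        length rest' \<le> length todo + length (B # rest) \<and>
        (new' \<longrightarrow> new \<or> length rest' < length todo + length (B # rest)) \<and>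
        t \<le> length todo * (K * (6 * X)) + 2)"
      proof (rule Cons.IH)
        show "elim_inv n L Bs rs (todo @ B # rest)"
          unfolding B by (rule elim_inv_rotate[OF inv])
      qed (use s' False Cons.prems B in \<open>simp_all add: enc_blocks_def\<close>)
      then show ?thesis
        by (rule wp_frame) (elim exE conjE, intro exI conjI, assumption+, use s' KX in auto)
    qed
  qed
qed

text \<open>A round either removes a pending set or ends with the flag cleared, so
  \<open>length rest + of_bool new\<close> decreases and bounds the number of rounds.\<close>

lemma wp_round_loop:
  assumes "s vREST = enc_blocks rest" and "s vRS = enc_list enc_row rs" and "s vNEW = enc_bool new"
    and "elim_inv n L Bs rs rest"
    and "\<not> new \<longrightarrow> (\<forall>B \<in> set rest. \<not> contained n rs (fst B))"
  shows "wp round_loop s (\<lambda>t s'. \<exists>rest' rs'. s' vRS = enc_list enc_row rs' \<and>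
    elim_inv n L Bs rs' rest' \<and> (\<forall>B \<in> set rest'. \<not> contained n rs' (fst B)) \<and>
    t \<le> (length rest + of_bool new) * (length Bs * (K * (7 * X))) + 2)"
  using assms
proof (induction "length rest + of_bool new" arbitrary: s rest rs new rule: less_induct)
  case less
  show ?case
  proof (cases new)
    case False
    then show ?thesis using less.prems by (simp add: wp_While_Leaf) blast
  next
    case True
    have ne: "eval_exp (EVar vNEW) s \<noteq> Leaf" using less.prems(3) True by simp
    let ?R = "length Bs * (K * (7 * X))"
    have "length rest \<le> length Bs" using less.prems(4) by (simp add: elim_inv_def)
    then have "length rest * (K * (6 * X)) \<le> length Bs * (K * (6 * X))" by (rule mult_le_mono1)
    moreover have "length Bs * (K * (6 * X)) = 6 * (length Bs * (K * X))"
      "?R = 7 * (length Bs * (K * X))"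
      by simp_all
    moreover have "1 * (K * X) \<le> length Bs * (K * X)"
      using length_Bs_ge_1 by (rule mult_le_mono1)
    ultimately have R: "length rest * (K * (6 * X)) + 50 \<le> ?R"
      using X_le_KX quantum_ge(2) by linarith
    let ?P = "\<lambda>t s'. \<exists>rest' rs' new'. s' vREST = enc_blocks rest' \<and>
        s' vRS = enc_list enc_row rs' \<and> s' vNEW = enc_bool new' \<and> elim_inv n L Bs rs' rest' \<and>
        (\<not> new' \<longrightarrow> (\<forall>B \<in> set rest'. \<not> contained n rs' (fst B))) \<and>
        length rest' + of_bool new' < length rest + 1 \<and>
        t \<le> length rest * (K * (6 * X)) + 20"
    have "wp round_body s ?P"
      unfolding round_body_def
    proof (rule wp_SeqI)
      show "wp (Seq (Assign vNEW ENil) (Seq (Assign vTODO (EVar vREST)) (Assign vREST ENil))) s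
        (\<lambda>t s'. s' vTODO = enc_blocks rest \<and> s' vREST = enc_blocks [] \<and>
          s' vRS = enc_list enc_row rs \<and> s' vNEW = enc_bool False \<and> t = 6)"
        using less.prems by (simp add: enc_blocks_def)
    next
      fix t :: nat and s' :: store
      assume s': "s' vTODO = enc_blocks rest \<and> s' vREST = enc_blocks [] \<and>
          s' vRS = enc_list enc_row rs \<and> s' vNEW = enc_bool False \<and> t = 6"
      have "wp scan_loop s' (\<lambda>t s'. \<exists>rest' rs' new'. s' vREST = enc_blocks rest' \<and>
        s' vRS = enc_list enc_row rs' \<and> s' vNEW = enc_bool new' \<and> elim_inv n L Bs rs' rest' \<and>
        (\<not> new' \<longrightarrow> (\<forall>B \<in> set rest'. \<not> contained n rs' (fst B))) \<and>
        length rest' \<le> length rest + length ([] :: block list) \<and>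
        (new' \<longrightarrow> False \<or> length rest' < length rest + length ([] :: block list)) \<and>
        t \<le> length rest * (K * (6 * X)) + 2)"
        by (rule wp_scan_loop) (use s' less.prems(4) in simp_all)
      then show "wp scan_loop s' (\<lambda>u. ?P (t + u))"
        by (rule wp_frame) (elim exE conjE, intro exI conjI, assumption+, use s' in auto)
    qed
    with ne show ?thesis
    proof (rule wp_WhileI)
      fix t :: nat and s' :: store
      assume "?P t s'"
      then obtain rest' rs' new' where s': "s' vREST = enc_blocks rest'"
          "s' vRS = enc_list enc_row rs'" "s' vNEW = enc_bool new'" "elim_inv n L Bs rs' rest'"
          "\<not> new' \<longrightarrow> (\<forall>B \<in> set rest'. \<not> contained n rs' (fst B))"
        and dec: "length rest' + of_bool new' < length rest + 1"
        and t: "t \<le> length rest * (K * (6 * X)) + 20"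
        by (elim exE conjE)
      have dec': "length rest' + of_bool new' < length rest + of_bool new" using dec True by simp
      have "(length rest' + of_bool new' + 1) * ?R \<le> (length rest + of_bool new) * ?R"
        using dec' by (intro mult_le_mono1) simp
      then have T: "(length rest' + of_bool new') * ?R + ?R \<le> (length rest + of_bool new) * ?R"
        by (simp only: add_mult_distrib mult_1)
      from less.hyps[OF dec' s']
      show "wp round_loop s' (\<lambda>u s''. \<exists>rest' rs'. s'' vRS = enc_list enc_row rs' \<and>
        elim_inv n L Bs rs' rest' \<and> (\<forall>B \<in> set rest'. \<not> contained n rs' (fst B)) \<and>
        1 + exp_time (EVar vNEW) + t + u \<le> (length rest + of_bool new) * ?R + 2)"
      proof (rule wp_frame, elim exE conjE, intro exI conjI)
        fix u rest'' rs'' s''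
        assume "u \<le> (length rest' + of_bool new') * ?R + 2"
        then show "1 + exp_time (EVar vNEW) + t + u \<le> (length rest + of_bool new) * ?R + 2"
          using T R t unfolding exp_time.simps by linarith
      qed assumption+
    qed
  qed
qed

text \<open>With \<open>m\<close> sets there are at most \<open>m + 1\<close>, hence at most
  \<open>2 * m\<close>, rounds of cost \<open>7 * m * K * X\<close>; the remaining two units cover
  the final feasibility call and the overhead.\<close>

lemma wp_elim_com:
  assumes "s 0 = enc_blocks Bs"
  shows "wp elim_com s (\<lambda>t s'. s' 0 = enc_bool (carrier_vec n - (\<Union>B \<in> set Bs. block_set n B) = {}) \<and>
    t \<le> 16 * ((length Bs)\<^sup>2 * K * X))"
proof -
  obtain eqs r Bs' where Bs: "Bs = (eqs, r) # Bs'"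
    using length_Bs_ge_1 by (cases Bs) auto
  then have mem: "(eqs, r) \<in> set Bs" by simp
  have ok: "row_ok n L r" by (rule elim_instanceD(2)[OF inst mem])
  let ?R = "length Bs * (K * (7 * X))"
  have "1 * (1 * (K * X)) \<le> length Bs * (length Bs * (K * X))"
    by (intro mult_le_mono length_Bs_ge_1 order_refl)
  moreover have "(length Bs + 1) * ?R \<le> (2 * length Bs) * ?R"
    using length_Bs_ge_1 by (intro mult_le_mono1) simp
  moreover have "(2 * length Bs) * ?R = 14 * (length Bs * (length Bs * (K * X)))"
    "(length Bs)\<^sup>2 * K * X = length Bs * (length Bs * (K * X))"
    by (simp_all add: power2_eq_square)
  ultimately have T: "(length Bs + 1) * ?R + 2 * X \<le> 16 * ((length Bs)\<^sup>2 * K * X)"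
    using X_le_KX by linarith
  have obj: "vOBJ \<notin> modified round_loop" using modified_round_body by auto
  show ?thesis
    unfolding elim_com_def
  proof (rule wp_SeqI)
    show "wp (Seq (Assign vREST (EVar 0)) (Seq (Assign vOBJ (ETl (EHd (EVar 0))))
        (Seq (Assign vRS ENil) (Assign vNEW ETrue)))) s
      (\<lambda>t s'. s' vREST = enc_blocks Bs \<and> s' vOBJ = enc_row r \<and> s' vRS = enc_list enc_row [] \<and>
        s' vNEW = enc_bool True \<and> t = 12)"
      using assms Bs by (simp add: enc_blocks_def)
  next
    fix t1 :: nat and s1 :: store
    assume s1: "s1 vREST = enc_blocks Bs \<and> s1 vOBJ = enc_row r \<and> s1 vRS = enc_list enc_row [] \<and>
        s1 vNEW = enc_bool True \<and> t1 = 12"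
    let ?ans = "enc_bool (carrier_vec n - (\<Union>B \<in> set Bs. block_set n B) = {})"
    have "wp round_loop s1 (\<lambda>t s'. \<exists>rest' rs'. s' vRS = enc_list enc_row rs' \<and>
        elim_inv n L Bs rs' rest' \<and> (\<forall>B \<in> set rest'. \<not> contained n rs' (fst B)) \<and>
        t \<le> (length Bs + of_bool True) * ?R + 2)"
      by (rule wp_round_loop[where rs = "[]"]) (use s1 elim_inv_init in simp_all)
    then show "wp (Seq round_loop (Seq (Assign vROW (EVar vOBJ)) (Seq lp_call
        (Cond (EVar 0) (Assign 0 ENil) (Assign 0 ETrue))))) s1
      (\<lambda>u s'. s' 0 = ?ans \<and> t1 + u \<le> 16 * ((length Bs)\<^sup>2 * K * X))"
    proof (rule wp_SeqI)
      fix t2 :: nat and s2 :: store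
      assume "\<exists>rest' rs'. s2 vRS = enc_list enc_row rs' \<and>
          elim_inv n L Bs rs' rest' \<and> (\<forall>B \<in> set rest'. \<not> contained n rs' (fst B)) \<and>
          t2 \<le> (length Bs + of_bool True) * ?R + 2"
        and f2: "\<forall>x. x \<notin> modified round_loop \<longrightarrow> s2 x = s1 x"
      then obtain rest rs where RS: "s2 vRS = enc_list enc_row rs"
        and inv: "elim_inv n L Bs rs rest" "\<forall>B \<in> set rest. \<not> contained n rs (fst B)"
        and t2: "t2 \<le> (length Bs + 1) * ?R + 2"
        by auto
      have OBJ: "s2 vOBJ = enc_row r" using f2 obj s1 by simp
      note rs = elim_inv_rows[OF inv(1)]
      have ans: "?ans = enc_bool (feasible_set n rs = {})"
        using elim_inv_final[OF inst inv] by simp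
      show "wp (Seq (Assign vROW (EVar vOBJ)) (Seq lp_call
          (Cond (EVar 0) (Assign 0 ENil) (Assign 0 ETrue)))) s2
        (\<lambda>u s'. s' 0 = ?ans \<and> t1 + (t2 + u) \<le> 16 * ((length Bs)\<^sup>2 * K * X))"
      proof (rule wp_SeqI)
        show "wp (Assign vROW (EVar vOBJ)) s2 (\<lambda>t s'. s' = s2(vROW := enc_row r) \<and> t = 2)"
          using OBJ by simp
      next
        fix t3 :: nat and s3 :: store
        assume s3: "s3 = s2(vROW := enc_row r) \<and> t3 = 2"
        have "s3 vROW = enc_row r" "s3 vRS = enc_list enc_row rs" using s3 RS by simp_all
        from wp_lp_call[OF this ok rs]
        show "wp (Seq lp_call (Cond (EVar 0) (Assign 0 ENil) (Assign 0 ETrue))) s3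
          (\<lambda>u s'. s' 0 = ?ans \<and> t1 + (t2 + (t3 + u)) \<le> 16 * ((length Bs)\<^sup>2 * K * X))"
        proof (rule wp_SeqI)
          fix t4 :: nat and s4 :: store
          assume "\<exists>res. lp_answer n (fst r) rs res \<and> s4 0 = enc_lp_result res \<and>
            (\<forall>x. N < x \<longrightarrow> s4 x = s3 x) \<and> t4 \<le> LP n k L + 2 * N + 10"
          then obtain res where res: "lp_answer n (fst r) rs res" "s4 0 = enc_lp_result res"
            and t4: "t4 \<le> X"
            using quantum_ge(1) by (meson order_trans)
          have time: "t1 + (t2 + (t3 + (t4 + 20))) \<le> 16 * ((length Bs)\<^sup>2 * K * X)"
            using T t2 t4 s1 s3 quantum_ge(2) by linarith
          have "feasible_set n rs = {} \<longleftrightarrow> s4 0 = Leaf"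
            using res by (cases res) auto
          then show "wp (Cond (EVar 0) (Assign 0 ENil) (Assign 0 ETrue)) s4
            (\<lambda>u s'. s' 0 = ?ans \<and> t1 + (t2 + (t3 + (t4 + u))) \<le> 16 * ((length Bs)\<^sup>2 * K * X))"
            unfolding ans using time by simp
        qed
      qed
    qed
  qed
qed

end

theorem theorem13:
  fixes lp :: com and LP :: "nat \<Rightarrow> nat \<Rightarrow> nat \<Rightarrow> nat"
  assumes "solves_linear_programming lp LP"
  shows "\<exists>p C. solves_subspace_elimination p (\<lambda>n m K L. C * (m\<^sup>2 * K * LP n (m * K) L))"
proof -
  \<comment> \<open>This bounds the solver's variables and depends on \<open>lp\<close> alone, so
    the constant \<open>16 * (2 * N + 3000)\<close> is the same for all instances.\<close>
  define N where "N = Max (insert 0 (com_vars lp))"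
  have "com_vars lp \<subseteq> {..N}"
    unfolding N_def using finite_com_vars[of lp] by auto
  then interpret lp_solver lp LP N
    using assms by unfold_locales
  have "\<exists>t. computes elim_com (enc_blocks Bs)
      (enc_bool (carrier_vec n - (\<Union>B \<in> set Bs. block_set n B) = {})) t \<and>
      t \<le> 16 * (2 * N + 3000) * ((length Bs)\<^sup>2 * max_eqs Bs * LP n (length Bs * max_eqs Bs) L)"
    if "elim_instance n L Bs" for n L Bs
  proof -
    interpret elimination_run lp LP N n L Bs
      using that by unfold_locales
    have "wp elim_com ((\<lambda>_. Leaf)(0 := enc_blocks Bs))
      (\<lambda>t s'. s' 0 = enc_bool (carrier_vec n - (\<Union>B \<in> set Bs. block_set n B) = {}) \<and>
        t \<le> 16 * ((length Bs)\<^sup>2 * K * X))"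
      by (rule wp_elim_com) simp
    then obtain t s' where "exec elim_com ((\<lambda>_. Leaf)(0 := enc_blocks Bs)) t s'"
      "s' 0 = enc_bool (carrier_vec n - (\<Union>B \<in> set Bs. block_set n B) = {})"
      and t: "t \<le> 16 * ((length Bs)\<^sup>2 * K * X)"
      unfolding wp_def by (elim exE conjE)
    then have "computes elim_com (enc_blocks Bs)
      (enc_bool (carrier_vec n - (\<Union>B \<in> set Bs. block_set n B) = {})) t"
      unfolding computes_def by (intro exI conjI)
    moreover have "16 * ((length Bs)\<^sup>2 * K * X) =
        16 * (2 * N + 3000) * ((length Bs)\<^sup>2 * max_eqs Bs * LP n (length Bs * max_eqs Bs) L)"
      by (simp only: quantum_def ac_simps)
    ultimately show ?thesis using t by (intro exI conjI) (assumption, simp only:)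
  qed
  then have "solves_subspace_elimination elim_com
      (\<lambda>n m K L. 16 * (2 * N + 3000) * (m\<^sup>2 * K * LP n (m * K) L))"
    unfolding solves_subspace_elimination_def by simp
  then show ?thesis by (intro exI)
qed

end
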